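(* Let $g\in\mathcal{C}(\overline{\mathbb{D}})$, $\gamma_0,\gamma\in\mathcal{C}(\mathbb{T})$ and $c\in\mathbb{C}$. Suppose that $w\in\mathcal{C}^{4}(\mathbb{D})\cap\mathcal{C}(\overline{\mathbb{D}})$ satisfies $$(\partial_z\partial_{\overline z})^2w=g \text{ in }\mathbb{D},\qquad w=\gamma_0\text{ on }\mathbb{T},\qquad \partial_\nu\partial_z\partial_{\overline z}w=\gamma\text{ on }\mathbb{T},$$ together with $$\frac{1}{2\pi i}\int_{\mathbb{T}}w_{\zeta\overline{\zeta}}(\zeta)\frac{d\zeta}{\zeta}=c\qquad\text{and}\qquad \frac{1}{2\pi}\int_0^{2\pi}\gamma(e^{it})\,dt=2\int_{\mathbb{D}}g(\zeta)\,dA(\zeta).$$ Then for every $z\in\overline{\mathbb{D}}$, $$\left|w(z)-\frac{1-|z|^2}{1+|z|^2}\mathcal{P}_{\gamma_0}(0)\right|\le\frac{4}{\pi}\|\mathcal{P}_{\gamma_0}\|_\infty\arctan|z|+|c|+\|\gamma\|_\infty N_1(|z|)+\|g\|_\infty N_2(|z|),$$ where $$N_1(t)=2\log 4+\frac{1-t^2}{2}\left(\frac{2}{3}\pi^2-2\right)^{1/2}+4\left(\frac{\pi^2}{6}\right)^{1/2},$$ $$N_2(t)=4\log 4+(1-t^2)\left(\frac{2}{3}\pi^2-2\right)^{1/2}+\frac{16}{3}\left(\frac{\pi^2}{6}\right)^{1/2}.$$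
   Context: $\mathbb{D}=\{z\in\mathbb{C}:|z|<1\}$, $\mathbb{T}=\partial\mathbb{D}$, $\overline{\mathbb{D}}=\mathbb{D}\cup\mathbb{T}$. Functions are complex-valued; $\mathcal{C}(\cdot)$ denotes continuous functions. $\partial_z=\frac12(\partial_x-i\partial_y)$, $\partial_{\overline z}=\frac12(\partial_x+i\partial_y)$, $w_{\zeta\overline\zeta}=\partial_\zeta\partial_{\overline\zeta}w$, and $\partial_\nu$ denotes differentiation in the outward normal direction on $\mathbb{T}$. $dA(\zeta)=\frac1\pi\,dx\,dy$ is the normalized area measure on $\mathbb{D}$. The Poisson integral is $$\mathcal{P}_{\gamma_0}(z)=\frac{1}{2\pi}\int_0^{2\pi}\frac{1-|z|^2}{|1-ze^{-it}|^2}\gamma_0(e^{it})\,dt,\quad z\in\mathbb{D}.$$ Norms: $\|\mathcal{P}_{\gamma_0}\|_\infty=\sup_{z\in\mathbb{D}}|\mathcal{P}_{\gamma_0}(z)|$, $\|\gamma\|_\infty=\sup_{z\in\mathbb{T}}|\gamma(z)|$, $\|g\|_\infty=\sup_{z\in\mathbb{D}}|g(z)|$. *)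

theory Defs
  imports "HOL-Complex_Analysis.Contour_Integration"
begin

text \<open>
  Wirtinger derivatives. The Frechet derivative is the one over the reals, so its values at
  \<open>1\<close> and \<open>\<i>\<close> are the partial derivatives with respect to $x$ and $y$. The value is only
  meaningful at points of real differentiability.
\<close>

definition partial_x :: "(complex \<Rightarrow> complex) \<Rightarrow> complex \<Rightarrow> complex" where
  "partial_x f z = frechet_derivative f (at z) 1"

definition partial_y :: "(complex \<Rightarrow> complex) \<Rightarrow> complex \<Rightarrow> complex" where
  "partial_y f z = frechet_derivative f (at z) \<i>"

definition d_z :: "(complex \<Rightarrow> complex) \<Rightarrow> complex \<Rightarrow> complex" where
  "d_z f z = (partial_x f z - \<i> * partial_y f z) / 2"

definition d_zbar :: "(complex \<Rightarrow> complex) \<Rightarrow> complex \<Rightarrow> complex" where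
  "d_zbar f z = (partial_x f z + \<i> * partial_y f z) / 2"

definition d_zzbar :: "(complex \<Rightarrow> complex) \<Rightarrow> complex \<Rightarrow> complex" where
  "d_zzbar f = d_z (d_zbar f)"

text \<open>The class $C^k(S)$, in the real sense, for an open set $S$ of the plane.\<close>

fun C_k_on :: "nat \<Rightarrow> complex set \<Rightarrow> (complex \<Rightarrow> complex) \<Rightarrow> bool" where
  "C_k_on 0 S f \<longleftrightarrow> continuous_on S f"
| "C_k_on (Suc k) S f \<longleftrightarrow>
     (\<forall>z\<in>S. f differentiable (at z)) \<and> C_k_on k S (partial_x f) \<and> C_k_on k S (partial_y f)"

text \<open>
  A function given in the open disc is extended to the unit circle by its boundary limits.
  The result is continuous on the closed disc iff the function has a continuous extension
  to the closed disc, and it is then that extension.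
\<close>

definition disc_ext :: "(complex \<Rightarrow> complex) \<Rightarrow> complex \<Rightarrow> complex" where
  "disc_ext f z = (if z \<in> ball 0 1 then f z else Lim (at z within ball 0 1) f)"

text \<open>
  At a point \<open>\<zeta>\<close> of the unit circle the outward unit normal is \<open>\<zeta>\<close> itself. The function is
  only considered in the closed disc, so the derivative is one-sided.
\<close>

definition has_normal_derivative ::
    "(complex \<Rightarrow> complex) \<Rightarrow> complex \<Rightarrow> complex \<Rightarrow> bool" where
  "has_normal_derivative F d \<zeta> \<longleftrightarrow>
     ((\<lambda>r::real. F (r *\<^sub>R \<zeta>)) has_vector_derivative d) (at 1 within {0..1})"

definition disc_area_integral :: "(complex \<Rightarrow> complex) \<Rightarrow> complex" where
  "disc_area_integral g = (1 / pi) *\<^sub>R integral (ball 0 1) g"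

definition poisson :: "(complex \<Rightarrow> complex) \<Rightarrow> complex \<Rightarrow> complex" where
  "poisson \<gamma> z = (1 / (2 * pi)) *\<^sub>R
     integral {0..2 * pi} (\<lambda>t. ((1 - (cmod z)\<^sup>2) / (cmod (1 - z * cis (- t)))\<^sup>2) *\<^sub>R \<gamma> (cis t))"

definition sup_norm_on :: "complex set \<Rightarrow> (complex \<Rightarrow> complex) \<Rightarrow> real" where
  "sup_norm_on S f = (SUP z\<in>S. cmod (f z))"

definition N\<^sub>1 :: "real \<Rightarrow> real" where
  "N\<^sub>1 t = 2 * ln 4 + (1 - t\<^sup>2) / 2 * sqrt (2 / 3 * pi\<^sup>2 - 2) + 4 * sqrt (pi\<^sup>2 / 6)"

definition N\<^sub>2 :: "real \<Rightarrow> real" where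
  "N\<^sub>2 t = 4 * ln 4 + (1 - t\<^sup>2) * sqrt (2 / 3 * pi\<^sup>2 - 2) + 16 / 3 * sqrt (pi\<^sup>2 / 6)"

end

theory Submission
  imports Defs "HOL-Complex_Analysis.Complex_Analysis"
begin

text \<open>
  Everything rests on maximum principles. Let $v$ be the continuous extension of
  $w_{z\overline z}$, $\Gamma = \|\gamma\|_\infty$ and $G = \|g\|_\infty$. On the upper half disc
  the function $v(z) - v(\overline z)$ vanishes on the diameter, and comparison with an explicit
  quadratic barrier bounds it by $3 \Gamma + 4 G$. Rotating the picture bounds the oscillation of
  $v$ on the circle, whose mean is $c$, so
  $|v - c| \le 3 \Gamma + 4 G$ there and $|v| \le |c| + 3 \Gamma + 5 G =: M$ in the disc. Comparing with
  $M (1 - |z|^2)$ then gives $|w - \mathcal{P}_{\gamma_0}| \le M$, and $N_1 \ge 3$, $N_2 \ge 5$. The remaining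
  term is Schwarz's lemma for harmonic functions: the Poisson kernel at $z$ exceeds
  $(1 - |z|^2) / (1 + |z|^2)$ exactly on the half circle nearest to $z$, so the $L^1$ norm of the
  difference is an explicit arctangent.
\<close>

section \<open>Wirtinger derivatives\<close>

text \<open>Neumann data fix v only up to an additive constant, so no comparison function on the
  whole disc can bound v itself. Subtracting the reflected function cancels the constant and creates
  the missing Dirichlet condition, namely zero on the diameter; the mean c restores the constant at
  the end. Two points x, y of the circle are mirror images in the line through a square root of xy,
  so the estimate for reflection in the real axis, applied to rotated functions, reaches every pair.

  In the barrier, x^2 - y^2 has normal derivative 2 cos 2\<theta> on the circle, which is negative
  around the top; adding 4y gives 2 cos 2\<theta> + 4 sin \<theta>, which is at least 2 on the upper
  half circle. The numbers 3 and 4 are the maxima of the two quadratics on the circle.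

  Comparisons are made strict by a small positive excess, so that a maximum point is excluded by
  one-variable calculus; the excess then tends to 0. Complex values are reduced to real ones by
  bounding the real part of \<mu> v for every unimodular \<mu>.\<close>

text \<open>The mean value theorem in the direction \<open>u\<close> turns the second difference
  into h times a difference of two values of \<open>D x u\<close> near \<open>z\<close>;
  differentiability of \<open>D x u\<close> at the single point \<open>z\<close> evaluates it as h *
  \<open>A v\<close> up to o(h). The quotient is symmetric in \<open>u\<close> and \<open>v\<close>,
  which yields the symmetry of second derivatives.\<close>

lemma second_difference_tendsto:
  fixes f :: "'a::real_normed_vector \<Rightarrow> real"
  assumes S: "open S" "z \<in> S"
    and D: "\<And>x. x \<in> S \<Longrightarrow> (f has_derivative D x) (at x)"
    and A: "((\<lambda>x. D x u) has_derivative A) (at z)"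
  shows "((\<lambda>h. (f (z + h *\<^sub>R u + h *\<^sub>R v) - f (z + h *\<^sub>R u) - f (z + h *\<^sub>R v) + f z) / h\<^sup>2)
           \<longlongrightarrow> A v) (at_right 0)"
proof (rule tendstoI)
  fix e :: real assume "e > 0"
  \<comment> \<open>The two linearization errors, at \<sigma>u + hv and at \<sigma>u, have total
    weight at most h (2 |u| + |v|); the summand 1 keeps \<open>K\<close> positive when both vectors
    vanish.\<close>
  define K where "K = 2 * norm u + norm v + 1"
  have K: "K > 0" by (simp add: K_def add_nonneg_pos)
  have linA: "linear A" using A has_derivative_linear by blast
  from A \<open>e > 0\<close> K obtain d where d: "d > 0"
    and dA: "\<And>y. norm (y - z) < d \<Longrightarrow> norm (D y u - D z u - A (y - z)) \<le> e / (2 * K) * norm (y - z)"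
    unfolding has_derivative_at_alt using K by (elim conjE allE[of _ "e / (2 * K)"]) auto
  from S obtain r where r: "r > 0" "ball z r \<subseteq> S" using open_contains_ball by blast
  define m where "m = min d r / K"
  have m: "m > 0" using d r K by (simp add: m_def)
  have "dist ((f (z + h *\<^sub>R u + h *\<^sub>R v) - f (z + h *\<^sub>R u) - f (z + h *\<^sub>R v) + f z) / h\<^sup>2) (A v) < e"
    if h: "0 < h" "h < m" for h
  proof -
    have hK: "h * K < min d r" using h K by (simp add: m_def field_simps)
    have small: "norm (s *\<^sub>R u + t *\<^sub>R v) < min d r" if "0 \<le> s" "s \<le> h" "t = 0 \<or> t = h" for s t
    proof -
      have "norm (s *\<^sub>R u + t *\<^sub>R v) \<le> s * norm u + t * norm v"
        using that h norm_triangle_ineq[of "s *\<^sub>R u" "t *\<^sub>R v"] by auto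
      also have "\<dots> \<le> h * norm u + h * norm v"
        using that h by (intro add_mono mult_right_mono) auto
      also have "\<dots> \<le> h * K" using h by (simp add: K_def algebra_simps)
      finally show ?thesis using hK by linarith
    qed
    have inS: "z + (s *\<^sub>R u + t *\<^sub>R v) \<in> S" if "0 \<le> s" "s \<le> h" "t = 0 \<or> t = h" for s t
      using small[OF that] by (intro subsetD[OF r(2)]) (simp add: dist_norm[of "z + _"] dist_commute[of z])
    \<comment> \<open>The term \<open>0 *\<^sub>R v\<close> is kept so that both points have the
      form z + (s u + t v) with t = 0 or t = h and share the facts stated for general
      \<open>t\<close>.\<close>
    define g where "g s = f (z + (s *\<^sub>R u + h *\<^sub>R v)) - f (z + (s *\<^sub>R u + 0 *\<^sub>R v))" for s
    define g' where "g' s = D (z + (s *\<^sub>R u + h *\<^sub>R v)) u - D (z + (s *\<^sub>R u + 0 *\<^sub>R v)) u" for s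
    have *: "((\<lambda>s. f (z + (s *\<^sub>R u + t *\<^sub>R v))) has_real_derivative D (z + (s *\<^sub>R u + t *\<^sub>R v)) u) (at s)"
      if "0 \<le> s" "s \<le> h" "t = 0 \<or> t = h" for s t
    proof -
      have "((\<lambda>s. z + (s *\<^sub>R u + t *\<^sub>R v)) has_derivative (\<lambda>s. s *\<^sub>R u)) (at s)"
        by (auto intro!: derivative_eq_intros)
      from has_derivative_compose[OF this D[OF inS[OF that]]]
      show ?thesis
        using linear_scale[OF has_derivative_linear[OF D[OF inS[OF that]]]]
        by (simp add: has_field_derivative_def mult.commute[of _ "D _ u"])
    qed
    have "(g has_real_derivative g' s) (at s)" if "0 \<le> s" "s \<le> h" for s
      unfolding g_def g'_def by (intro DERIV_diff * that) auto
    from MVT2[OF h(1), of g g', OF this] obtain \<sigma> where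
      \<sigma>: "0 < \<sigma>" "\<sigma> < h" "g h - g 0 = h * g' \<sigma>" by auto
    have E: "\<bar>D (z + (\<sigma> *\<^sub>R u + t *\<^sub>R v)) u - D z u - A (\<sigma> *\<^sub>R u + t *\<^sub>R v)\<bar>
        \<le> e / (2 * K) * (h * norm u + t * norm v)" if "t = 0 \<or> t = h" for t
    proof -
      have "norm (\<sigma> *\<^sub>R u + t *\<^sub>R v) \<le> \<sigma> * norm u + t * norm v"
        using that h \<sigma> norm_triangle_ineq[of "\<sigma> *\<^sub>R u" "t *\<^sub>R v"] by auto
      also have "\<dots> \<le> h * norm u + t * norm v" using \<sigma> by (simp add: mult_right_mono)
      finally have "e / (2 * K) * norm (\<sigma> *\<^sub>R u + t *\<^sub>R v) \<le> e / (2 * K) * (h * norm u + t * norm v)"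
        using \<open>e > 0\<close> K by (intro mult_left_mono) auto
      then show ?thesis
        using dA[of "z + (\<sigma> *\<^sub>R u + t *\<^sub>R v)"] small[of \<sigma> t] \<sigma> that by simp
    qed
    have lin: "A (\<sigma> *\<^sub>R u + h *\<^sub>R v) = A (\<sigma> *\<^sub>R u + 0 *\<^sub>R v) + h * A v"
      using linA by (simp add: linear_add linear_scale)
    have "\<bar>g' \<sigma> - h * A v\<bar> \<le> e / (2 * K) * (h * norm u + h * norm v) + e / (2 * K) * (h * norm u + 0 * norm v)"
      using E[of h] E[of 0] lin unfolding g'_def by linarith
    also have "\<dots> = e / (2 * K) * (h * (2 * norm u + norm v))" by (simp add: algebra_simps)
    also have "\<dots> \<le> e / (2 * K) * (h * K)"
      using \<open>e > 0\<close> K h by (intro mult_left_mono) (auto simp: K_def)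
    also have "\<dots> = e / 2 * h" using K by simp
    finally have b: "\<bar>g' \<sigma> - h * A v\<bar> \<le> e / 2 * h" .
    have "(f (z + h *\<^sub>R u + h *\<^sub>R v) - f (z + h *\<^sub>R u) - f (z + h *\<^sub>R v) + f z) / h\<^sup>2 - A v
        = (g' \<sigma> - h * A v) / h"
      using \<sigma>(3) h by (simp add: g_def field_simps power2_eq_square)
    also have "\<bar>\<dots>\<bar> \<le> e / 2" using b h by (simp add: abs_divide field_simps)
    finally show ?thesis using \<open>e > 0\<close> by (simp add: dist_real_def)
  qed
  then show "\<forall>\<^sub>F h in at_right 0. dist ((f (z + h *\<^sub>R u + h *\<^sub>R v) - f (z + h *\<^sub>R u) - f (z + h *\<^sub>R v) + f z) / h\<^sup>2) (A v) < e"
    using m unfolding eventually_at_right_field by (intro exI[of _ m]) auto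
qed

lemma second_derivative_symmetric_real:
  fixes f :: "'a::real_normed_vector \<Rightarrow> real"
  assumes "open S" "z \<in> S" "\<And>x. x \<in> S \<Longrightarrow> (f has_derivative D x) (at x)"
    and "((\<lambda>x. D x u) has_derivative A) (at z)" "((\<lambda>x. D x v) has_derivative B) (at z)"
  shows "A v = B u"
proof -
  have "((\<lambda>h. (f (z + h *\<^sub>R u + h *\<^sub>R v) - f (z + h *\<^sub>R u) - f (z + h *\<^sub>R v) + f z) / h\<^sup>2) \<longlongrightarrow> B u) (at_right 0)"
    using second_difference_tendsto[OF assms(1-3,5), of u] by (simp add: algebra_simps)
  with second_difference_tendsto[OF assms(1-4), of v] show ?thesis
    by (intro tendsto_unique[OF trivial_limit_at_right_real])
qed

text \<open>The mean value theorem is real-valued, so the real and imaginary parts are treated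
  separately.\<close>

lemma second_derivative_symmetric:
  fixes f :: "'a::real_normed_vector \<Rightarrow> complex"
  assumes S: "open S" "z \<in> S" and D: "\<And>x. x \<in> S \<Longrightarrow> (f has_derivative D x) (at x)"
    and "((\<lambda>x. D x u) has_derivative A) (at z)" "((\<lambda>x. D x v) has_derivative B) (at z)"
  shows "A v = B u"
proof (rule complex_eqI)
  show "Re (A v) = Re (B u)"
    by (rule second_derivative_symmetric_real[OF S, where f = "\<lambda>x. Re (f x)" and D = "\<lambda>x h. Re (D x h)"])
      (intro has_derivative_Re assms; assumption)+
  show "Im (A v) = Im (B u)"
    by (rule second_derivative_symmetric_real[OF S, where f = "\<lambda>x. Im (f x)" and D = "\<lambda>x h. Im (D x h)"])
      (intro has_derivative_Im assms; assumption)+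
qed

text \<open>Here $p = \partial_z f$ and $q = \partial_{\overline z} f$.\<close>

definition has_wirtinger :: "(complex \<Rightarrow> complex) \<Rightarrow> complex \<Rightarrow> complex \<Rightarrow> complex \<Rightarrow> bool" where
  "has_wirtinger f p q z \<longleftrightarrow> (f has_derivative (\<lambda>h. p * h + q * cnj h)) (at z)"

text \<open>The witnesses \<open>p\<close>, \<open>q\<close> are the first derivatives and
  \<open>l\<close>, \<open>m\<close> the pure second ones. Having the same \<open>L\<close> in both
  lines builds in the equality of the mixed derivatives, so that the notion is stable under
  conjugation and reflection, which exchange \<open>p\<close> and \<open>q\<close>. Only pointwise
  differentiability is asked for, which is what a second derivative test along lines uses.\<close>

definition zzbar_on :: "complex set \<Rightarrow> (complex \<Rightarrow> complex) \<Rightarrow> (complex \<Rightarrow> complex) \<Rightarrow> bool" where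
  "zzbar_on S f L \<longleftrightarrow> (\<exists>p q l m. \<forall>z\<in>S. has_wirtinger f (p z) (q z) z \<and>
     has_wirtinger q (L z) (m z) z \<and> has_wirtinger p (l z) (L z) z)"

section \<open>Closure properties: linear combinations, conjugation, rotation, reflection\<close>

lemma wirtinger_add: "has_wirtinger f p q z \<Longrightarrow> has_wirtinger g p' q' z \<Longrightarrow> has_wirtinger (\<lambda>z. f z + g z) (p + p') (q + q') z"
  unfolding has_wirtinger_def by (auto intro!: derivative_eq_intros simp: algebra_simps)

lemma wirtinger_cmult: "has_wirtinger f p q z \<Longrightarrow> has_wirtinger (\<lambda>z. c * f z) (c * p) (c * q) z"
  unfolding has_wirtinger_def by (auto intro!: derivative_eq_intros simp: algebra_simps)

lemma wirtinger_cnj: "has_wirtinger f p q z \<Longrightarrow> has_wirtinger (\<lambda>z. cnj (f z)) (cnj q) (cnj p) z"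
  unfolding has_wirtinger_def by (auto intro!: derivative_eq_intros simp: algebra_simps)

lemma wirtinger_compose_cmult: "has_wirtinger f p q (c * z) \<Longrightarrow> has_wirtinger (\<lambda>z. f (c * z)) (c * p) (cnj c * q) z"
  unfolding has_wirtinger_def
  using has_derivative_compose[of "\<lambda>z. c * z" "\<lambda>h. c * h" z UNIV f "\<lambda>h. p * h + q * cnj h"]
    has_derivative_mult_right[OF has_derivative_ident, of c "at z"]
  by (simp add: mult_ac)

lemma wirtinger_compose_cnj: "has_wirtinger f p q (cnj z) \<Longrightarrow> has_wirtinger (\<lambda>z. f (cnj z)) q p z"
  unfolding has_wirtinger_def
  using has_derivative_compose[of cnj cnj z UNIV f "\<lambda>h. p * h + q * cnj h"]
    has_derivative_cnj[OF has_derivative_ident, of "at z"]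
  by (simp add: add.commute)

lemma wirtinger_holomorphic: "(f has_field_derivative d) (at z) \<Longrightarrow> has_wirtinger f d 0 z"
  by (simp add: has_wirtinger_def has_field_derivative_def)

lemma zzbar_on_add:
  assumes "zzbar_on S f L" "zzbar_on S g M"
  shows "zzbar_on S (\<lambda>z. f z + g z) (\<lambda>z. L z + M z)"
proof -
  from assms obtain p q l m p' q' l' m' where
    "\<forall>z\<in>S. has_wirtinger f (p z) (q z) z \<and> has_wirtinger q (L z) (m z) z \<and> has_wirtinger p (l z) (L z) z"
    "\<forall>z\<in>S. has_wirtinger g (p' z) (q' z) z \<and> has_wirtinger q' (M z) (m' z) z \<and> has_wirtinger p' (l' z) (M z) z"
    unfolding zzbar_on_def by blast
  then show ?thesis unfolding zzbar_on_def
    by (intro exI[of _ "\<lambda>z. p z + p' z"] exI[of _ "\<lambda>z. q z + q' z"]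
        exI[of _ "\<lambda>z. l z + l' z"] exI[of _ "\<lambda>z. m z + m' z"]) (simp add: wirtinger_add)
qed

lemma zzbar_on_cmult:
  assumes "zzbar_on S f L"
  shows "zzbar_on S (\<lambda>z. c * f z) (\<lambda>z. c * L z)"
proof -
  from assms obtain p q l m where
    "\<forall>z\<in>S. has_wirtinger f (p z) (q z) z \<and> has_wirtinger q (L z) (m z) z \<and> has_wirtinger p (l z) (L z) z"
    unfolding zzbar_on_def by blast
  then show ?thesis unfolding zzbar_on_def
    by (intro exI[of _ "\<lambda>z. c * p z"] exI[of _ "\<lambda>z. c * q z"]
        exI[of _ "\<lambda>z. c * l z"] exI[of _ "\<lambda>z. c * m z"]) (simp add: wirtinger_cmult)
qed

lemma zzbar_on_diff:
  "zzbar_on S f L \<Longrightarrow> zzbar_on S g M \<Longrightarrow> zzbar_on S (\<lambda>z. f z - g z) (\<lambda>z. L z - M z)"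
  using zzbar_on_add[OF _ zzbar_on_cmult[of S g M "-1"], of f L] by simp

lemma zzbar_on_cnj:
  assumes "zzbar_on S f L"
  shows "zzbar_on S (\<lambda>z. cnj (f z)) (\<lambda>z. cnj (L z))"
proof -
  from assms obtain p q l m where
    "\<forall>z\<in>S. has_wirtinger f (p z) (q z) z \<and> has_wirtinger q (L z) (m z) z \<and> has_wirtinger p (l z) (L z) z"
    unfolding zzbar_on_def by blast
  then show ?thesis unfolding zzbar_on_def
    by (intro exI[of _ "\<lambda>z. cnj (q z)"] exI[of _ "\<lambda>z. cnj (p z)"]
        exI[of _ "\<lambda>z. cnj (m z)"] exI[of _ "\<lambda>z. cnj (l z)"]) (simp add: wirtinger_cnj)
qed

text \<open>The chain rule contributes a factor \<open>c\<close> for the z-derivative and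
  \<open>cnj c\<close> for the other; in the mixed derivative they multiply to |c|^2 = 1.\<close>

lemma zzbar_on_compose_cmult:
  assumes "zzbar_on S f L" "\<And>z. z \<in> T \<Longrightarrow> c * z \<in> S" "cmod c = 1"
  shows "zzbar_on T (\<lambda>z. f (c * z)) (\<lambda>z. L (c * z))"
proof -
  from assms obtain p q l m where
    *: "\<forall>z\<in>S. has_wirtinger f (p z) (q z) z \<and> has_wirtinger q (L z) (m z) z \<and> has_wirtinger p (l z) (L z) z"
    unfolding zzbar_on_def by blast
  have c: "cnj c * (c * x) = x" "c * (cnj c * x) = x" for x
    using assms(3) complex_norm_square[of c] by (simp_all add: mult.assoc[symmetric] mult.commute)
  have "has_wirtinger (\<lambda>z. cnj c * q (c * z)) (L (c * z)) (cnj c * (cnj c * m (c * z))) z"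
    "has_wirtinger (\<lambda>z. c * p (c * z)) (c * (c * l (c * z))) (L (c * z)) z" if "z \<in> T" for z
    using wirtinger_cmult[OF wirtinger_compose_cmult[of q "L (c * z)" "m (c * z)" c z], of "cnj c"]
      wirtinger_cmult[OF wirtinger_compose_cmult[of p "l (c * z)" "L (c * z)" c z], of c]
      * assms(2)[OF that] by (simp_all add: c)
  then show ?thesis unfolding zzbar_on_def using * assms(2)
    by (intro exI[of _ "\<lambda>z. c * p (c * z)"] exI[of _ "\<lambda>z. cnj c * q (c * z)"]
        exI[of _ "\<lambda>z. c * (c * l (c * z))"] exI[of _ "\<lambda>z. cnj c * (cnj c * m (c * z))"])
       (simp add: wirtinger_compose_cmult)
qed

lemma zzbar_on_compose_cnj:
  assumes "zzbar_on S f L" "\<And>z. z \<in> T \<Longrightarrow> cnj z \<in> S"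
  shows "zzbar_on T (\<lambda>z. f (cnj z)) (\<lambda>z. L (cnj z))"
proof -
  from assms obtain p q l m where
    "\<forall>z\<in>S. has_wirtinger f (p z) (q z) z \<and> has_wirtinger q (L z) (m z) z \<and> has_wirtinger p (l z) (L z) z"
    unfolding zzbar_on_def by blast
  then show ?thesis unfolding zzbar_on_def using assms(2)
    by (intro exI[of _ "\<lambda>z. q (cnj z)"] exI[of _ "\<lambda>z. p (cnj z)"]
        exI[of _ "\<lambda>z. m (cnj z)"] exI[of _ "\<lambda>z. l (cnj z)"]) (simp add: wirtinger_compose_cnj)
qed

lemma zzbar_on_subset: "zzbar_on S f L \<Longrightarrow> T \<subseteq> S \<Longrightarrow> zzbar_on T f L"
  unfolding zzbar_on_def by blast

lemma zzbar_on_cong: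
  assumes "zzbar_on S f L" "open S" "\<And>z. z \<in> S \<Longrightarrow> f z = g z" "\<And>z. z \<in> S \<Longrightarrow> L z = M z"
  shows "zzbar_on S g M"
proof -
  from assms obtain p q l m where
    "\<forall>z\<in>S. has_wirtinger f (p z) (q z) z \<and> has_wirtinger q (L z) (m z) z \<and> has_wirtinger p (l z) (L z) z"
    unfolding zzbar_on_def by blast
  then show ?thesis unfolding zzbar_on_def using assms(4)
    by (intro exI[of _ p] exI[of _ q] exI[of _ l] exI[of _ m])
      (auto simp: has_wirtinger_def intro: has_derivative_transform_within_open[OF _ assms(2) _ assms(3)])
qed

lemma zzbar_on_holomorphic:
  assumes "f holomorphic_on S" "open S"
  shows "zzbar_on S f (\<lambda>z. 0)"
proof -
  have "has_wirtinger f (deriv f z) 0 z" "has_wirtinger (deriv f) (deriv (deriv f) z) 0 z" "has_wirtinger (\<lambda>z. 0) 0 0 z"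
    if "z \<in> S" for z
    using that holomorphic_derivI[OF assms]
      holomorphic_derivI[OF holomorphic_deriv[OF assms] assms(2)]
    by (auto intro!: wirtinger_holomorphic)
  then show ?thesis unfolding zzbar_on_def
    by (intro exI[of _ "deriv f"] exI[of _ "\<lambda>z. 0"] exI[of _ "deriv (deriv f)"]) auto
qed

lemma zzbar_on_norm_square: "zzbar_on S (\<lambda>z. z * cnj z) (\<lambda>z. 1)"
proof -
  have "has_wirtinger (\<lambda>z. z * cnj z) (cnj z) z z" "has_wirtinger (\<lambda>z. z) 1 0 z" "has_wirtinger cnj 0 1 z" for z
    unfolding has_wirtinger_def by (auto intro!: derivative_eq_intros simp: algebra_simps)
  then show ?thesis unfolding zzbar_on_def
    by (intro exI[of _ cnj] exI[of _ "\<lambda>z. z"] exI[of _ "\<lambda>z. 0"]) auto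
qed

section \<open>The classes C^k under the Wirtinger operators\<close>

text \<open>The recursion for \<open>C_k_on\<close> speaks of the total functions
  \<open>partial_x f\<close> and \<open>partial_y f\<close>, whereas formulas for them, such as
  linearity, hold only at points of differentiability. This transfer along equality on an open set
  bridges the two.\<close>

lemma C_k_on_cong:
  assumes "open S" "\<And>z. z \<in> S \<Longrightarrow> f z = g z" "C_k_on k S f"
  shows "C_k_on k S g"
  using assms
proof (induction k arbitrary: f g)
  case 0
  then show ?case using continuous_on_cong[of S S f g] by simp
next
  case (Suc k)
  have fr: "frechet_derivative f (at z) = frechet_derivative g (at z)" if "z \<in> S" for z
    using that Suc.prems by (intro frechet_derivative_transform_within_open[of f z S g]) auto
  have "g differentiable (at z)" if "z \<in> S" for z
    using that Suc.prems has_derivative_transform_within_open[of f _ z UNIV S g]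
    unfolding differentiable_def by (metis C_k_on.simps(2) differentiable_def)
  moreover have "partial_x f z = partial_x g z" "partial_y f z = partial_y g z" if "z \<in> S" for z
    using fr[OF that] by (simp_all add: partial_x_def partial_y_def)
  then have "C_k_on k S (partial_x g)" "C_k_on k S (partial_y g)"
    using Suc.IH[of "partial_x f" "partial_x g"] Suc.IH[of "partial_y f" "partial_y g"] Suc.prems
    by simp_all
  ultimately show ?case by simp
qed

lemma C_k_on_Suc_imp: "C_k_on (Suc k) S f \<Longrightarrow> C_k_on k S f"
proof (induction k arbitrary: f)
  case 0
  then have "f differentiable_on S"
    by (auto intro: differentiable_at_imp_differentiable_on)
  then show ?case using differentiable_imp_continuous_on by simp
next
  case (Suc k)
  then show ?case
    unfolding C_k_on.simps(2)[of "Suc k" S f] C_k_on.simps(2)[of k S f] by blast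
qed

lemma C_k_on_lincomb:
  assumes "open S" "C_k_on k S f" "C_k_on k S g"
  shows "C_k_on k S (\<lambda>z. a * f z + b * g z)"
  using assms
proof (induction k arbitrary: f g)
  case 0
  then show ?case by (auto intro!: continuous_intros)
next
  case (Suc k)
  have D: "((\<lambda>z. a * f z + b * g z) has_derivative
      (\<lambda>h. a * frechet_derivative f (at z) h + b * frechet_derivative g (at z) h)) (at z)"
    if "z \<in> S" for z
    using Suc.prems that
    by (intro has_derivative_add has_derivative_mult_right) (auto simp: frechet_derivative_works)
  note fr = frechet_derivative_at[OF D, symmetric]
  have "partial_x (\<lambda>z. a * f z + b * g z) z = a * partial_x f z + b * partial_x g z"
    "partial_y (\<lambda>z. a * f z + b * g z) z = a * partial_y f z + b * partial_y g z"
    if "z \<in> S" for z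
    using fr[OF that] by (simp_all add: partial_x_def partial_y_def)
  moreover have "C_k_on k S (\<lambda>z. a * partial_x f z + b * partial_x g z)"
    "C_k_on k S (\<lambda>z. a * partial_y f z + b * partial_y g z)"
    using Suc.prems by (auto intro!: Suc.IH)
  ultimately have "C_k_on k S (partial_x (\<lambda>z. a * f z + b * g z))"
    "C_k_on k S (partial_y (\<lambda>z. a * f z + b * g z))"
    using C_k_on_cong[OF \<open>open S\<close>] by (metis (no_types, lifting))+
  then show ?case using D by (auto simp: differentiable_def)
qed

lemma C_k_on_d_z: "open S \<Longrightarrow> C_k_on (Suc k) S f \<Longrightarrow> C_k_on k S (d_z f)"
  using C_k_on_lincomb[of S k "partial_x f" "partial_y f" "1 / 2" "- \<i> / 2"]
  by (simp add: d_z_def[abs_def] diff_divide_distrib)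

lemma C_k_on_d_zbar: "open S \<Longrightarrow> C_k_on (Suc k) S f \<Longrightarrow> C_k_on k S (d_zbar f)"
  using C_k_on_lincomb[of S k "partial_x f" "partial_y f" "1 / 2" "\<i> / 2"]
  by (simp add: d_zbar_def[abs_def] add_divide_distrib)

lemma wirtinger_differentiable:
  assumes "f differentiable (at z)"
  shows "has_wirtinger f (d_z f z) (d_zbar f z) z"
proof -
  let ?D = "frechet_derivative f (at z)"
  have D: "(f has_derivative ?D) (at z)" using assms frechet_derivative_works by blast
  have "?D h = d_z f z * h + d_zbar f z * cnj h" for h
  proof -
    have "h = Re h *\<^sub>R 1 + Im h *\<^sub>R \<i>" by (simp add: complex_eq_iff)
    then have "?D h = ?D (Re h *\<^sub>R 1 + Im h *\<^sub>R \<i>)" by simp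
    also have "\<dots> = Re h *\<^sub>R ?D 1 + Im h *\<^sub>R ?D \<i>"
      using has_derivative_linear[OF D] by (simp only: linear_add linear_scale)
    also have "\<dots> = d_z f z * h + d_zbar f z * cnj h"
      by (simp add: d_z_def d_zbar_def partial_x_def partial_y_def complex_eq_iff field_simps)
    finally show ?thesis .
  qed
  then have "?D = (\<lambda>h. d_z f z * h + d_zbar f z * cnj h)" by blast
  with D show ?thesis unfolding has_wirtinger_def by metis
qed

text \<open>Both sides expand to a quarter of the Laplacian plus a multiple of the difference of the
  two mixed real derivatives, and that difference vanishes by symmetry.\<close>

lemma d_z_d_zbar_commute:
  assumes "open S" "C_k_on 2 S f" "z \<in> S"
  shows "d_zbar (d_z f) z = d_z (d_zbar f) z"
proof -
  have f: "f differentiable (at x)" and fx: "partial_x f differentiable (at x)"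
    and fy: "partial_y f differentiable (at x)" if "x \<in> S" for x
    using assms that by (auto simp: numeral_2_eq_2)
  have sym: "frechet_derivative (partial_x f) (at z) \<i> = frechet_derivative (partial_y f) (at z) 1"
    by (rule second_derivative_symmetric[OF assms(1,3), of f "\<lambda>x. frechet_derivative f (at x)"])
      (use f fx[OF assms(3)] fy[OF assms(3)] in
        \<open>auto simp: frechet_derivative_works partial_x_def[abs_def] partial_y_def[abs_def]\<close>)
  have D: "((\<lambda>x. (partial_x f x + c * partial_y f x) / 2) has_derivative
     (\<lambda>h. (frechet_derivative (partial_x f) (at z) h + c * frechet_derivative (partial_y f) (at z) h) / 2)) (at z)"
    for c
    using fx[OF assms(3)] fy[OF assms(3)]
    by (auto intro!: derivative_eq_intros simp: frechet_derivative_works)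
  have "frechet_derivative (d_z f) (at z) =
     (\<lambda>h. (frechet_derivative (partial_x f) (at z) h - \<i> * frechet_derivative (partial_y f) (at z) h) / 2)"
    using frechet_derivative_at[OF D[of "-\<i>"]] by (simp add: d_z_def[abs_def])
  moreover have "frechet_derivative (d_zbar f) (at z) =
     (\<lambda>h. (frechet_derivative (partial_x f) (at z) h + \<i> * frechet_derivative (partial_y f) (at z) h) / 2)"
    using frechet_derivative_at[OF D[of "\<i>"]] by (simp add: d_zbar_def[abs_def])
  ultimately show ?thesis
    unfolding d_z_def[of "d_zbar f"] d_zbar_def[of "d_z f"] partial_x_def[of "d_zbar f"]
      partial_x_def[of "d_z f"] partial_y_def[of "d_zbar f"] partial_y_def[of "d_z f"]
    using sym by (simp add: field_simps)
qed

lemma zzbar_on_d_zzbar: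
  assumes S: "open S" and f: "C_k_on 2 S f"
  shows "zzbar_on S f (d_zzbar f)"
proof -
  have 1: "C_k_on 1 S (d_z f)" "C_k_on 1 S (d_zbar f)"
    using C_k_on_d_z[OF S, of 1 f] C_k_on_d_zbar[OF S, of 1 f] f by (simp_all add: numeral_2_eq_2)
  have "has_wirtinger f (d_z f z) (d_zbar f z) z \<and>
     has_wirtinger (d_zbar f) (d_zzbar f z) (d_zbar (d_zbar f) z) z \<and>
     has_wirtinger (d_z f) (d_z (d_z f) z) (d_zzbar f z) z" if z: "z \<in> S" for z
    using wirtinger_differentiable[of f z] wirtinger_differentiable[of "d_zbar f" z]
      wirtinger_differentiable[of "d_z f" z] f 1 z d_z_d_zbar_commute[OF S f z]
    by (simp add: d_zzbar_def numeral_2_eq_2)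
  then show ?thesis unfolding zzbar_on_def by blast
qed

lemma C_k_on_d_zzbar:
  assumes "open S" "C_k_on (Suc (Suc k)) S f"
  shows "C_k_on k S (d_zzbar f)"
  unfolding d_zzbar_def using assms by (intro C_k_on_d_z C_k_on_d_zbar)

section \<open>Maximum principles\<close>

text \<open>At a maximum the derivative vanishes; as it has positive slope at 0 it is positive just
  to the right, and the mean value theorem produces a larger value there.\<close>

lemma not_local_max_real:
  fixes \<phi> :: "real \<Rightarrow> real"
  assumes d: "d > 0" and D: "\<And>t. \<bar>t\<bar> < d \<Longrightarrow> (\<phi> has_real_derivative \<phi>' t) (at t)"
    and D2: "(\<phi>' has_real_derivative A) (at 0)" and A: "A > 0"
  shows "\<exists>t. \<bar>t\<bar> < d \<and> \<phi> 0 < \<phi> t"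
proof (rule ccontr)
  assume "\<not> ?thesis"
  then have le: "\<bar>t\<bar> < d \<Longrightarrow> \<phi> t \<le> \<phi> 0" for t by force
  have 0: "\<phi>' 0 = 0"
    using DERIV_local_max[of \<phi> "\<phi>' 0" 0 d] D[of 0] d le by simp
  obtain e where e: "e > 0" "\<And>h. 0 < h \<Longrightarrow> h < e \<Longrightarrow> \<phi>' h > 0"
    using DERIV_pos_inc_right[OF D2 A] 0 by auto
  define h where "h = min d e / 2"
  have h: "0 < h" "h < d" "h < e" using d e by (auto simp: h_def)
  obtain t where "0 < t" "t < h" "\<phi> h - \<phi> 0 = (h - 0) * \<phi>' t"
    using MVT2[of 0 h \<phi> \<phi>'] D h by (metis abs_of_nonneg order_le_less_trans)
  then have "\<phi> h > \<phi> 0" using e(2)[of t] h by (smt (verit) mult_pos_pos)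
  with le[of h] h show False by simp
qed

text \<open>The mixed derivative is a quarter of the Laplacian, so a positive real part forces a
  positive second derivative of \<open>Re f\<close> along the real or the imaginary direction, and
  the one-variable test applies to that line.\<close>

lemma zzbar_not_local_max:
  assumes "open S" "z \<in> S" "zzbar_on S f L" "Re (L z) > 0"
  shows "\<exists>y\<in>S. Re (f y) > Re (f z)"
proof -
  from assms(3) obtain p q l m where
    W: "\<And>z. z \<in> S \<Longrightarrow> has_wirtinger f (p z) (q z) z \<and> has_wirtinger q (L z) (m z) z \<and> has_wirtinger p (l z) (L z) z"
    unfolding zzbar_on_def by blast
  obtain r where r: "r > 0" "ball z r \<subseteq> S" using assms open_contains_ball by blast
  have along: "((\<lambda>t. Re (b * g (z + t *\<^sub>R a))) has_real_derivative
      Re (b * (P * a + Q * cnj a))) (at t)"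
    if "has_wirtinger g P Q (z + t *\<^sub>R a)" for g P Q a b and t :: real
  proof -
    have "((\<lambda>t. z + t *\<^sub>R a) has_derivative (\<lambda>h. h *\<^sub>R a)) (at t)"
      by (auto intro!: derivative_eq_intros)
    from has_derivative_Re[OF has_derivative_mult_right[OF has_derivative_compose[OF this that[unfolded has_wirtinger_def]], of b]]
    show ?thesis unfolding has_field_derivative_def
      by (rule has_derivative_eq_rhs) (auto simp: fun_eq_iff algebra_simps)
  qed
  have inS: "z + t *\<^sub>R a \<in> S" if "\<bar>t\<bar> < r" "cmod a = 1" for t a
    using that by (intro subsetD[OF r(2)]) (simp add: dist_norm)
  have dir: "\<exists>y\<in>S. Re (f y) > Re (f z)"
    if a: "cmod a = 1" "Re (a * (l z * a + L z * cnj a) + cnj a * (L z * a + m z * cnj a)) > 0" for a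
  proof -
    have 1: "((\<lambda>t. Re (f (z + t *\<^sub>R a))) has_real_derivative
        Re (a * p (z + t *\<^sub>R a)) + Re (cnj a * q (z + t *\<^sub>R a))) (at t)" if "\<bar>t\<bar> < r" for t
      using along[of f "p (z + t *\<^sub>R a)" "q (z + t *\<^sub>R a)" t a 1] W[OF inS[OF that a(1)]]
      by (simp add: algebra_simps)
    have 2: "((\<lambda>t. Re (a * p (z + t *\<^sub>R a)) + Re (cnj a * q (z + t *\<^sub>R a))) has_real_derivative
        Re (a * (l z * a + L z * cnj a)) + Re (cnj a * (L z * a + m z * cnj a))) (at 0)"
      by (intro DERIV_add along) (use W[OF assms(2)] in simp_all)
    have 3: "Re (a * (l z * a + L z * cnj a)) + Re (cnj a * (L z * a + m z * cnj a)) > 0"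
      using a(2) by simp
    obtain t where t: "\<bar>t\<bar> < r" "Re (f (z + 0 *\<^sub>R a)) < Re (f (z + t *\<^sub>R a))"
      using not_local_max_real[OF r(1) 1 2 3] by auto
    then show ?thesis using inS[OF t(1) a(1)] by auto
  qed
  \<comment> \<open>These are the second derivatives in the directions 1 and i; they add up to 4
    \<open>Re (L z)\<close>.\<close>
  have "Re (l z + L z + (L z + m z)) > 0 \<or> Re (- l z + L z + (L z - m z)) > 0"
    using assms(4) by simp linarith
  then show ?thesis using dir[of 1] dir[of \<i>] by (auto simp: algebra_simps)
qed

lemma zzbar_le_boundary_strict:
  assumes "continuous_on (cball 0 1) f" "zzbar_on (ball 0 1) f L"
    and "\<And>z. z \<in> ball 0 1 \<Longrightarrow> Re (L z) > 0"
    and "\<And>z. z \<in> sphere 0 1 \<Longrightarrow> Re (f z) \<le> M" and "z \<in> cball 0 1"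
  shows "Re (f z) \<le> M"
proof -
  obtain x where x: "x \<in> cball 0 1" "\<And>y. y \<in> cball 0 1 \<Longrightarrow> Re (f y) \<le> Re (f x)"
    using continuous_attains_sup[of "cball 0 1" "\<lambda>z. Re (f z)", OF _ _ continuous_on_Re[OF assms(1)]]
    by auto
  have "x \<notin> ball 0 1"
    using zzbar_not_local_max[OF open_ball _ assms(2)] assms(3) x(2) by (meson ball_subset_cball not_le subsetD)
  then have "x \<in> sphere 0 1" using x(1) by auto
  then show ?thesis using assms(4,5) x(2) by force
qed

text \<open>Adding e |z|^2 raises the mixed derivative by e > 0, so the strict version applies, and
  costs at most e on the circle.\<close>

lemma zzbar_le_boundary:
  assumes f: "continuous_on (cball 0 1) f" "zzbar_on (ball 0 1) f L"
    and L: "\<And>z. z \<in> ball 0 1 \<Longrightarrow> Re (L z) \<ge> 0"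
    and M: "\<And>z. z \<in> sphere 0 1 \<Longrightarrow> Re (f z) \<le> M" and z: "z \<in> cball 0 1"
  shows "Re (f z) \<le> M"
proof (rule field_le_epsilon)
  fix e :: real assume e: "e > 0"
  have "Re (f z + of_real e * (z * cnj z)) \<le> M + e"
  proof (rule zzbar_le_boundary_strict[OF _ _ _ _ z, where f = "\<lambda>z. f z + of_real e * (z * cnj z)"
        and L = "\<lambda>z. L z + of_real e * 1"])
    show "zzbar_on (ball 0 1) (\<lambda>z. f z + of_real e * (z * cnj z)) (\<lambda>z. L z + of_real e * 1)"
      by (intro zzbar_on_add f zzbar_on_cmult zzbar_on_norm_square)
    show "Re (f z + of_real e * (z * cnj z)) \<le> M + e" if "z \<in> sphere 0 1" for z
      using M[OF that] that by (simp add: complex_norm_square[symmetric])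
  qed (use f L e in \<open>auto intro!: continuous_intros add_nonneg_pos\<close>)
  moreover have "Re (of_real e * (z * cnj z)) \<ge> 0"
    using e by (simp add: complex_norm_square[symmetric])
  ultimately show "Re (f z) \<le> M + e" by simp
qed

lemma radial_derivative_nonneg:
  fixes \<phi> :: "real \<Rightarrow> real"
  assumes "(\<phi> has_real_derivative d) (at 1 within {0..1})" "\<And>r. r \<in> {0..1} \<Longrightarrow> \<phi> r \<le> \<phi> 1"
  shows "d \<ge> 0"
proof (rule ccontr)
  assume "\<not> d \<ge> 0"
  then obtain e where e: "e > 0" "\<And>h. h > 0 \<Longrightarrow> 1 - h \<in> {0..1} \<Longrightarrow> h < e \<Longrightarrow> \<phi> 1 < \<phi> (1 - h)"
    using has_real_derivative_neg_dec_left[OF assms(1)] by auto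
  define h where "h = min (e / 2) 1"
  have "0 < h" "h \<le> 1" "h < e" using e(1) by (auto simp: h_def min_def)
  then show False using e(2)[of h] assms(2)[of "1 - h"] by auto
qed

text \<open>A maximum point over the closed half disc is not interior, by the positivity of
  \<open>Re (L z)\<close>, and not on the open arc, where the function strictly decreases in the
  outward direction. So it lies on the diameter, whose end points are covered by the condition for
  \<open>Im z = 0\<close>.\<close>

lemma half_disc_le_0:
  assumes f: "continuous_on {z. cmod z \<le> 1 \<and> 0 \<le> Im z} f" "zzbar_on {z. cmod z < 1 \<and> 0 < Im z} f L"
    and L: "\<And>z. cmod z < 1 \<Longrightarrow> 0 < Im z \<Longrightarrow> Re (L z) > 0"
    and re: "\<And>z. Im z = 0 \<Longrightarrow> cmod z \<le> 1 \<Longrightarrow> Re (f z) \<le> 0"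
    and d: "\<And>z. cmod z = 1 \<Longrightarrow> 0 < Im z \<Longrightarrow>
       ((\<lambda>r. Re (f (of_real r * z))) has_real_derivative d z) (at 1 within {0..1}) \<and> d z < 0"
    and z: "cmod z \<le> 1" "0 \<le> Im z"
  shows "Re (f z) \<le> 0"
proof -
  let ?K = "{z. cmod z \<le> 1 \<and> 0 \<le> Im z}" and ?U = "{z. cmod z < 1 \<and> 0 < Im z}"
  have "?K = cball 0 1 \<inter> {z. 0 \<le> Im z}" by auto
  then have "compact ?K"
    by (simp add: compact_Int_closed closed_halfspace_Im_ge)
  then obtain x where x: "x \<in> ?K" "\<And>y. y \<in> ?K \<Longrightarrow> Re (f y) \<le> Re (f x)"
    using continuous_attains_sup[of ?K "\<lambda>z. Re (f z)", OF _ _ continuous_on_Re[OF f(1)]] z by auto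
  have "?U = ball 0 1 \<inter> {z. 0 < Im z}" by auto
  then have U: "open ?U" by (simp add: open_Int open_halfspace_Im_gt)
  have "x \<notin> ?U"
    using zzbar_not_local_max[OF U _ f(2), of x] L x(2) by (force simp: not_le[symmetric])
  moreover have False if "cmod x = 1" "0 < Im x"
  proof -
    have "d x \<ge> 0"
      by (rule radial_derivative_nonneg[of "\<lambda>r. Re (f (of_real r * x))"])
        (use d[OF that] x that in \<open>auto simp: norm_mult\<close>)
    then show False using d[OF that] by simp
  qed
  ultimately have "Im x = 0" using x(1) by force
  then show ?thesis using re[of x] x z by force
qed

section \<open>The Poisson integral\<close>

definition poisson_kernel :: "complex \<Rightarrow> real \<Rightarrow> real" where
  "poisson_kernel z t = (1 - (cmod z)\<^sup>2) / (cmod (1 - z * cis (- t)))\<^sup>2"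

lemma poisson_eq:
  "poisson \<gamma> z = (1 / (2 * pi)) *\<^sub>R integral {0..2 * pi} (\<lambda>t. poisson_kernel z t *\<^sub>R \<gamma> (cis t))"
  by (simp add: poisson_def poisson_kernel_def)

lemma one_minus_mult_cis_nonzero: "cmod z < 1 \<Longrightarrow> 1 - z * cis t \<noteq> 0"
  by (metis eq_iff_diff_eq_0 less_irrefl mult.right_neutral norm_cis norm_mult norm_one)

lemma continuous_on_poisson_kernel:
  "cmod z < 1 \<Longrightarrow> continuous_on S (poisson_kernel z)"
  unfolding poisson_kernel_def using one_minus_mult_cis_nonzero[of z]
  by (intro continuous_intros continuous_on_cis) auto

text \<open>With a = 1 - z e^(-it) one has |z|^2 = |1 - a|^2, and 1 - |1 - a|^2 = a + cnj a - |a|^2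
  is divided by |a|^2. This exhibits the kernel as holomorphic plus antiholomorphic in z.\<close>

lemma poisson_kernel_decompose:
  assumes "cmod z < 1"
  shows "of_real (poisson_kernel z t) = 1 / (1 - z * cis (- t)) + cnj (1 / (1 - z * cis (- t))) - 1"
proof -
  define a where "a = 1 - z * cis (- t)"
  have a: "a \<noteq> 0" using one_minus_mult_cis_nonzero[OF assms] by (simp add: a_def)
  have "complex_of_real ((cmod z)\<^sup>2) = (1 - a) * cnj (1 - a)"
    unfolding complex_norm_square[symmetric] by (simp add: a_def norm_mult)
  then have "of_real (poisson_kernel z t) = (1 - (1 - a) * cnj (1 - a)) / (a * cnj a)"
    unfolding poisson_kernel_def a_def[symmetric]
    by (simp only: of_real_divide of_real_diff of_real_1 complex_norm_square)
  also have "\<dots> = 1 / a + cnj (1 / a) - 1" using a by (simp add: field_simps)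
  finally show ?thesis by (simp add: a_def)
qed

lemma holomorphic_on_circle_integral:
  assumes "continuous_on {0..2 * pi} f"
  shows "(\<lambda>z. integral {0..2 * pi} (\<lambda>t. f t / (1 - z * cis (- t)))) holomorphic_on ball 0 1"
proof -
  have nz: "1 - z * cis (- t) \<noteq> 0" if "z \<in> ball 0 1" for z t
    using one_minus_mult_cis_nonzero that by auto
  have "(\<lambda>z. integral (cbox 0 (2 * pi)) (\<lambda>t. f t / (1 - z * cis (- t)))) holomorphic_on ball 0 1"
  proof (rule leibniz_rule_holomorphic[where fx = "\<lambda>z t. f t * cis (- t) / (1 - z * cis (- t))\<^sup>2"])
    show "((\<lambda>z. f t / (1 - z * cis (- t))) has_field_derivative f t * cis (- t) / (1 - z * cis (- t))\<^sup>2)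
        (at z within ball 0 1)" if "z \<in> ball 0 1" for z t
      using nz[OF that, of t] by (auto intro!: derivative_eq_intros simp: power2_eq_square)
    show "(\<lambda>t. f t / (1 - z * cis (- t))) integrable_on cbox 0 (2 * pi)" if "z \<in> ball 0 1" for z
      using assms nz[OF that] by (intro integrable_continuous continuous_intros) auto
    have "continuous_on (ball 0 1 \<times> cbox 0 (2 * pi)) (\<lambda>p. f (snd p))"
      using assms by (intro continuous_on_compose2[OF assms continuous_on_snd]) (auto intro: continuous_intros)
    then show "continuous_on (ball 0 1 \<times> cbox 0 (2 * pi))
        (\<lambda>(z, t). f t * cis (- t) / (1 - z * cis (- t))\<^sup>2)"
      unfolding case_prod_unfold using nz
      by (intro continuous_intros) (auto simp del: mem_ball)
  qed simp
  then show ?thesis by simp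
qed

lemma zzbar_on_poisson:
  assumes \<gamma>: "continuous_on (sphere 0 1) \<gamma>"
  shows "zzbar_on (ball 0 1) (poisson \<gamma>) (\<lambda>z. 0)"
proof -
  have c: "continuous_on {0..2 * pi} (\<lambda>t. \<gamma> (cis t))"
    by (intro continuous_on_compose2[OF \<gamma>] continuous_intros) auto
  \<comment> \<open>The data are conjugated in \<open>B\<close> so that \<open>cnj (B z)\<close> is
    the antiholomorphic part of the integral while \<open>B\<close> itself is holomorphic.\<close>
  define A B where "A = (\<lambda>z. integral {0..2 * pi} (\<lambda>t. \<gamma> (cis t) / (1 - z * cis (- t))))"
    and "B = (\<lambda>z. integral {0..2 * pi} (\<lambda>t. cnj (\<gamma> (cis t)) / (1 - z * cis (- t))))"
  have A: "zzbar_on (ball 0 1) A (\<lambda>z. 0)" and B: "zzbar_on (ball 0 1) B (\<lambda>z. 0)"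
    unfolding A_def B_def
    by (intro zzbar_on_holomorphic holomorphic_on_circle_integral c continuous_on_cnj open_ball)+
  have const: "zzbar_on (ball 0 1) (\<lambda>z. integral {0..2 * pi} (\<lambda>t. \<gamma> (cis t))) (\<lambda>z. 0)"
    by (intro zzbar_on_holomorphic) auto
  have eq: "of_real (1 / (2 * pi)) * (A z + cnj (B z) - integral {0..2 * pi} (\<lambda>t. \<gamma> (cis t))) = poisson \<gamma> z"
    if z: "z \<in> ball 0 1" for z
  proof -
    have nz: "1 - z * cis (- t) \<noteq> 0" for t
      using one_minus_mult_cis_nonzero z by auto
    have nz': "cnj z * cnj (cis (- t)) \<noteq> 1" for t
      using nz[of t] by (metis complex_cnj_mult complex_cnj_one_iff right_minus_eq)
    have iA: "(\<lambda>t. \<gamma> (cis t) / (1 - z * cis (- t))) integrable_on {0..2 * pi}"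
      and iB: "(\<lambda>t. cnj (cnj (\<gamma> (cis t)) / (1 - z * cis (- t)))) integrable_on {0..2 * pi}"
      and iC: "(\<lambda>t. \<gamma> (cis t)) integrable_on {0..2 * pi}"
      using c nz nz' by (auto intro!: integrable_continuous_interval continuous_intros)
    have "integral {0..2 * pi} (\<lambda>t. poisson_kernel z t *\<^sub>R \<gamma> (cis t)) =
      integral {0..2 * pi} (\<lambda>t. \<gamma> (cis t) / (1 - z * cis (- t)) +
         cnj (cnj (\<gamma> (cis t)) / (1 - z * cis (- t))) - \<gamma> (cis t))"
      using z by (simp add: scaleR_conv_of_real poisson_kernel_decompose algebra_simps)
    also have "\<dots> = A z + cnj (B z) - integral {0..2 * pi} (\<lambda>t. \<gamma> (cis t))"
      unfolding integral_diff[OF integrable_add[OF iA iB] iC] integral_add[OF iA iB]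
      by (simp add: A_def B_def integral_cnj)
    finally show ?thesis by (simp add: poisson_eq scaleR_conv_of_real)
  qed
  show ?thesis
    by (rule zzbar_on_cong[OF zzbar_on_cmult[OF zzbar_on_diff[OF zzbar_on_add[OF A zzbar_on_cnj[OF B]] const]]
          open_ball eq]) auto
qed

lemma zzbar_on_continuous:
  assumes "zzbar_on S f L" "z \<in> S"
  shows "isCont f z"
  using assms unfolding zzbar_on_def has_wirtinger_def by (blast intro: has_derivative_continuous)

section \<open>The kernel in polar coordinates and Schwarz's lemma\<close>

lemma poisson_kernel_polar:
  "poisson_kernel (of_real r * cis \<alpha>) t = (1 - r\<^sup>2) / (1 + r\<^sup>2 - 2 * r * cos (t - \<alpha>))"
proof -
  define s where "s = t - \<alpha>"
  have "1 - of_real r * cis \<alpha> * cis (- t) = Complex (1 - r * cos s) (r * sin s)"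
    by (simp add: s_def complex_eq_iff cos_diff sin_diff algebra_simps)
  then have "(cmod (1 - of_real r * cis \<alpha> * cis (- t)))\<^sup>2 = (1 - r * cos s)\<^sup>2 + (r * sin s)\<^sup>2"
    by (simp add: cmod_power2)
  also have "\<dots> = 1 + r\<^sup>2 - 2 * r * cos s"
    using sin_cos_squared_add[of s] by algebra
  finally show ?thesis by (simp add: poisson_kernel_def norm_mult s_def)
qed

text \<open>
  Integrating $1 + 2 \sum_{n \ge 1} r^n \cos n t$ termwise gives $t - 2 \arg (1 - r e^{i t})$, which is
  smooth on the whole line, unlike the primitive obtained by substituting $\tan (t / 2)$.
\<close>

definition poisson_primitive :: "real \<Rightarrow> real \<Rightarrow> real" where
  "poisson_primitive r t = t + 2 * arctan (r * sin t / (1 - r * cos t))"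

lemma poisson_denominator_pos:
  fixes r :: real
  assumes "0 \<le> r" "r < 1"
  shows "1 - r * cos t > 0" "1 + r\<^sup>2 - 2 * r * cos t > 0"
proof -
  have rc: "r * cos t \<le> r" using assms by (simp add: mult_left_le)
  then show "1 - r * cos t > 0" using assms by linarith
  have "0 < (1 - r)\<^sup>2" using assms by simp
  also have "\<dots> \<le> 1 + r\<^sup>2 - 2 * r * cos t" using rc by (simp add: power2_eq_square algebra_simps)
  finally show "1 + r\<^sup>2 - 2 * r * cos t > 0" .
qed

lemma poisson_primitive_deriv:
  assumes r: "0 \<le> r" "r < 1"
  shows "(poisson_primitive r has_real_derivative (1 - r\<^sup>2) / (1 + r\<^sup>2 - 2 * r * cos t)) (at t)"
proof -
  define D where "D = 1 + r\<^sup>2 - 2 * r * cos t"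
  define E where "E = 1 - r * cos t"
  have pos: "D > 0" "E > 0" using poisson_denominator_pos[OF r] by (auto simp: D_def E_def)
  have D: "E\<^sup>2 + (r * sin t)\<^sup>2 = D" and
    N: "r * cos t * E - r * sin t * (r * sin t) = r * cos t - r\<^sup>2"
    using sin_cos_squared_add[of t] unfolding D_def E_def by algebra+
  have u: "((\<lambda>t. r * sin t / (1 - r * cos t)) has_real_derivative
      (r * cos t * E - r * sin t * (r * sin t)) / (E * E)) (at t)"
    unfolding E_def using pos(2) by (auto intro!: derivative_eq_intros simp: E_def)
  have "(poisson_primitive r has_real_derivative
      1 + 2 * (inverse (1 + (r * sin t / E)\<^sup>2) * ((r * cos t * E - r * sin t * (r * sin t)) / (E * E)))) (at t)"
    unfolding poisson_primitive_def[abs_def]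
    by (intro DERIV_add DERIV_ident DERIV_cmult DERIV_chain2[OF DERIV_arctan u[unfolded E_def], unfolded E_def[symmetric]])
  moreover have "1 + (r * sin t / E)\<^sup>2 = D / E\<^sup>2"
    using pos D by (simp add: field_simps)
  then have "1 + 2 * (inverse (1 + (r * sin t / E)\<^sup>2) * ((r * cos t * E - r * sin t * (r * sin t)) / (E * E)))
     = 1 + 2 * (r * cos t - r\<^sup>2) / D"
    unfolding N using pos by (simp add: power2_eq_square)
  also have "\<dots> = (1 - r\<^sup>2) / D"
    using pos by (simp add: D_def field_simps)
  ultimately show ?thesis by (simp add: D_def)
qed

lemma has_integral_poisson_primitive:
  assumes "0 \<le> r" "r < 1" "a \<le> b"
  shows "((\<lambda>t. (1 - r\<^sup>2) / (1 + r\<^sup>2 - 2 * r * cos t)) has_integral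
           poisson_primitive r b - poisson_primitive r a) {a..b}"
  using poisson_primitive_deriv[OF assms(1,2)] assms(3)
  by (intro fundamental_theorem_of_calculus)
    (auto simp: has_real_derivative_iff_has_vector_derivative[symmetric] intro: has_field_derivative_at_within)

text \<open>For an antiderivative G, the increment G(x + p) - G(x) has derivative f(x + p) - f(x) =
  0, so it does not depend on x.\<close>

lemma integral_periodic:
  fixes f :: "real \<Rightarrow> 'a::banach"
  assumes c: "continuous_on UNIV f" and p: "\<And>t. f (t + p) = f t" "p \<ge> 0"
  shows "integral {a..a + p} f = integral {b..b + p} f"
proof -
  have *: "integral {a..a + p} f = integral {b..b + p} f" if "a \<le> b" for a b
  proof -
    obtain G where G: "\<And>x. x \<in> {a..b + p} \<Longrightarrow> (G has_vector_derivative f x) (at x within {a..b + p})"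
      using antiderivative_continuous[of a "b + p" f] continuous_on_subset[OF c] by auto
    have I: "integral {x..x + p} f = G (x + p) - G x" if "x \<in> {a..b}" for x
      using that p(2)
      by (intro integral_unique fundamental_theorem_of_calculus)
        (auto intro!: has_vector_derivative_within_subset[OF G])
    have "((\<lambda>x. G (x + p) - G x) has_vector_derivative 0) (at x within {a..b})" if "x \<in> {a..b}" for x
    proof -
      have "((\<lambda>x. G (x + p)) has_vector_derivative 1 *\<^sub>R f (x + p)) (at x within {a..b})"
        using that p(2) G[of "x + p"]
        by (intro vector_diff_chain_within[of "\<lambda>x. x + p" 1 x "{a..b}" G, unfolded o_def])
          (auto intro!: derivative_eq_intros elim: has_vector_derivative_within_subset)
      moreover have "(G has_vector_derivative f x) (at x within {a..b})"
        using that p(2) by (intro has_vector_derivative_within_subset[OF G]) auto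
      ultimately show ?thesis
        using has_vector_derivative_diff[of _ "1 *\<^sub>R f (x + p)" "at x within {a..b}" G "f x"] p(1) by simp
    qed
    from has_vector_derivative_zero_constant[OF _ this]
    obtain k where "\<And>x. x \<in> {a..b} \<Longrightarrow> G (x + p) - G x = k" by auto
    then show ?thesis using I[of a] I[of b] that by simp
  qed
  show ?thesis using *[of a b] *[of b a] by (metis linear)
qed

lemma continuous_on_circle:
  assumes "continuous_on (sphere 0 1) \<gamma>"
  shows "continuous_on S (\<lambda>t. \<gamma> (cis t))"
  by (intro continuous_on_compose2[OF assms] continuous_intros) auto

text \<open>The arctangent term of \<open>poisson_primitive\<close> is 2 pi-periodic, so over one
  period only the linear term t contributes.\<close>

lemma poisson_kernel_integral:
  assumes z: "cmod z < 1"
  shows "(poisson_kernel z has_integral 2 * pi) {0..2 * pi}"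
proof -
  define r \<alpha> where "r = cmod z" and "\<alpha> = Arg z"
  have r: "0 \<le> r" "r < 1" and z_eq: "z = of_real r * cis \<alpha>"
    using z by (auto simp: r_def \<alpha>_def rcis_def[symmetric] rcis_cmod_Arg)
  let ?k = "\<lambda>t. (1 - r\<^sup>2) / (1 + r\<^sup>2 - 2 * r * cos t)"
  have "((\<lambda>t. ?k (- \<alpha> + t)) has_integral poisson_primitive r (- \<alpha> + 2 * pi) - poisson_primitive r (- \<alpha>)) {0..2 * pi}"
    using has_integral_poisson_primitive[OF r, of "- \<alpha>" "- \<alpha> + 2 * pi"]
      has_integral_shift_Icc_real[of ?k "- \<alpha>" _ 0 "2 * pi"]
    by (simp add: o_def add.commute)
  moreover have "?k (- \<alpha> + t) = poisson_kernel z t" for t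
    unfolding z_eq poisson_kernel_polar by (simp add: algebra_simps)
  ultimately show ?thesis by (simp add: poisson_primitive_def sin_diff cos_diff)
qed

text \<open>Angles are measured from the argument of z, and the period starts at -pi/2, so that its
  first half is the half circle nearest to z and its second half the opposite one.\<close>

lemma poisson_shift:
  assumes \<gamma>: "continuous_on (sphere 0 1) \<gamma>" and r: "0 \<le> r" "r < 1"
  shows "poisson \<gamma> (of_real r * cis \<alpha>) = (1 / (2 * pi)) *\<^sub>R
    integral {- (pi / 2)..3 * pi / 2} (\<lambda>t. ((1 - r\<^sup>2) / (1 + r\<^sup>2 - 2 * r * cos t)) *\<^sub>R \<gamma> (cis (t + \<alpha>)))"
proof -
  define f where "f = (\<lambda>t. poisson_kernel (of_real r * cis \<alpha>) t *\<^sub>R \<gamma> (cis t))"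
  have z: "cmod (of_real r * cis \<alpha>) < 1" using r by (simp add: norm_mult)
  have per: "f (t + 2 * pi) = f t" for t
    unfolding f_def poisson_kernel_polar
    by (simp add: cis_mult[symmetric] cos_diff sin_diff)
  have cont: "continuous_on UNIV f"
    unfolding f_def by (intro continuous_intros continuous_on_poisson_kernel z continuous_on_circle \<gamma>)
  have "integral {0..2 * pi} f = integral {(- (pi / 2) + \<alpha>)..(3 * pi / 2 + \<alpha>)} f"
    using integral_periodic[OF cont per, of 0 "- (pi / 2) + \<alpha>"] by (simp add: algebra_simps)
  also have "\<dots> = integral {- (pi / 2)..3 * pi / 2} (f \<circ> (+) \<alpha>)"
    by (rule integral_shift_Icc_real[symmetric])
  also have "f \<circ> (+) \<alpha> = (\<lambda>t. ((1 - r\<^sup>2) / (1 + r\<^sup>2 - 2 * r * cos t)) *\<^sub>R \<gamma> (cis (t + \<alpha>)))"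
    by (simp add: f_def fun_eq_iff poisson_kernel_polar add.commute)
  finally show ?thesis by (simp add: poisson_eq f_def)
qed

lemma poisson_schwarz:
  assumes \<gamma>: "continuous_on (sphere 0 1) \<gamma>" and M: "\<And>x. x \<in> sphere 0 1 \<Longrightarrow> cmod (\<gamma> x) \<le> M"
    and z: "cmod z < 1"
  shows "cmod (poisson \<gamma> z - ((1 - (cmod z)\<^sup>2) / (1 + (cmod z)\<^sup>2)) *\<^sub>R poisson \<gamma> 0) \<le> 4 / pi * M * arctan (cmod z)"
proof -
  define r \<alpha> where "r = cmod z" and "\<alpha> = Arg z"
  have r: "0 \<le> r" "r < 1" and z_eq: "z = of_real r * cis \<alpha>"
    using z by (auto simp: r_def \<alpha>_def rcis_def[symmetric] rcis_cmod_Arg)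
  define k where "k = (1 - r\<^sup>2) / (1 + r\<^sup>2)"
  define K where "K = (\<lambda>t. (1 - r\<^sup>2) / (1 + r\<^sup>2 - 2 * r * cos t))"
  define h where "h = (\<lambda>t. \<gamma> (cis (t + \<alpha>)))"
  have pos: "1 + r\<^sup>2 > 0" "1 - r\<^sup>2 > 0" "\<And>t. 1 + r\<^sup>2 - 2 * r * cos t > 0"
    using r poisson_denominator_pos[OF r] by (auto simp: add_pos_nonneg power_less_one_iff abs_square_less_1)
  have ch: "continuous_on S h" for S unfolding h_def
    by (intro continuous_on_compose2[OF \<gamma>] continuous_intros) auto
  have cK: "continuous_on S K" for S unfolding K_def
    using pos(3) by (intro continuous_intros) (auto simp: less_imp_neq[symmetric])
  have int: "(\<lambda>t. K t *\<^sub>R h t) integrable_on {a..b}" "(\<lambda>t. k *\<^sub>R h t) integrable_on {a..b}"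
    "(\<lambda>t. (K t - k) *\<^sub>R h t) integrable_on {a..b}" for a b
    by (auto intro!: integrable_continuous_interval continuous_intros ch cK)
  let ?a = "- (pi / 2)" and ?b = "pi / 2" and ?c = "3 * pi / 2"
  have "poisson \<gamma> z = (1 / (2 * pi)) *\<^sub>R integral {?a..?c} (\<lambda>t. K t *\<^sub>R h t)"
    using poisson_shift[OF \<gamma> r, of \<alpha>] by (simp add: z_eq K_def h_def)
  moreover have "poisson \<gamma> 0 = (1 / (2 * pi)) *\<^sub>R integral {?a..?c} h"
    using poisson_shift[OF \<gamma>, of 0 \<alpha>] by (simp add: h_def)
  ultimately have "poisson \<gamma> z - k *\<^sub>R poisson \<gamma> 0 =
      (1 / (2 * pi)) *\<^sub>R (integral {?a..?c} (\<lambda>t. K t *\<^sub>R h t) - integral {?a..?c} (\<lambda>t. k *\<^sub>R h t))"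
    by (simp add: scaleR_diff_right)
  also have "integral {?a..?c} (\<lambda>t. K t *\<^sub>R h t) - integral {?a..?c} (\<lambda>t. k *\<^sub>R h t)
      = integral {?a..?c} (\<lambda>t. (K t - k) *\<^sub>R h t)"
    unfolding integral_diff[OF int(1,2), symmetric] by (simp add: scaleR_diff_left)
  also have "\<dots> = integral {?a..?b} (\<lambda>t. (K t - k) *\<^sub>R h t) + integral {?b..?c} (\<lambda>t. (K t - k) *\<^sub>R h t)"
    by (intro Henstock_Kurzweil_Integration.integral_combine[symmetric] int) (use pi_ge_zero in linarith)+
  finally have eq: "poisson \<gamma> z - k *\<^sub>R poisson \<gamma> 0 = (1 / (2 * pi)) *\<^sub>R \<dots>" .
  have KI: "(K has_integral poisson_primitive r b - poisson_primitive r a) {a..b}" if "a \<le> b" for a b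
    unfolding K_def by (rule has_integral_poisson_primitive[OF r that])
  have kI: "((\<lambda>t. k) has_integral (b - a) * k) {a..b}" if "a \<le> b" for a b
    using has_integral_const_real[of k a b] that by simp
  have trig: "sin ?c = - 1" "cos ?c = 0"
    using sin_3over2_pi cos_3over2_pi by (simp_all add: mult.commute)
  \<comment> \<open>At odd multiples of pi/2 the cosine vanishes, so the arctangent term reduces to
    arctan r or -arctan r.\<close>
  have prim: "poisson_primitive r ?b - poisson_primitive r ?a = pi + 4 * arctan r"
    "poisson_primitive r ?c - poisson_primitive r ?b = pi - 4 * arctan r"
    by (simp_all add: poisson_primitive_def trig arctan_minus)
  have hM: "cmod (h t) \<le> M" for t unfolding h_def by (rule M) simp
  have M0: "M \<ge> 0" using hM[of 0] norm_ge_zero order_trans by blast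
  have near: "cmod (integral {?a..?b} (\<lambda>t. (K t - k) *\<^sub>R h t)) \<le> (pi + 4 * arctan r - pi * k) * M"
  proof -
    have I: "((\<lambda>t. (K t - k) * M) has_integral (pi + 4 * arctan r - pi * k) * M) {?a..?b}"
      using has_integral_mult_left[OF has_integral_diff[OF KI[of ?a ?b] kI[of ?a ?b]], of M] prim by simp
    have "cmod ((K t - k) *\<^sub>R h t) \<le> (K t - k) * M" if "t \<in> {?a..?b}" for t
    proof -
      have "cos t \<ge> 0" using that by (intro cos_ge_zero) auto
      then have "K t \<ge> k" unfolding K_def k_def using pos r by (intro divide_left_mono mult_pos_pos) auto
      then show ?thesis using hM by (simp add: mult_left_mono)
    qed
    then show ?thesis unfolding integral_unique[OF I, symmetric]
      by (intro integral_norm_bound_integral int(3) has_integral_integrable[OF I])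
  qed
  have far: "cmod (integral {?b..?c} (\<lambda>t. (K t - k) *\<^sub>R h t)) \<le> (pi * k - (pi - 4 * arctan r)) * M"
  proof -
    have I: "((\<lambda>t. (k - K t) * M) has_integral (pi * k - (pi - 4 * arctan r)) * M) {?b..?c}"
      using has_integral_mult_left[OF has_integral_diff[OF kI[of ?b ?c] KI[of ?b ?c]], of M] prim by simp
    have "cmod ((K t - k) *\<^sub>R h t) \<le> (k - K t) * M" if "t \<in> {?b..?c}" for t
    proof -
      \<comment> \<open>Shifting by pi moves the far half period onto [-pi/2, pi/2], where the
        cosine is nonnegative.\<close>
      have "cos (t - pi) \<ge> 0" using that by (intro cos_ge_zero) auto
      then have "cos t \<le> 0" by (simp add: cos_diff)
      then have "r * cos t \<le> 0" using r by (simp add: mult_nonneg_nonpos)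
      then have "K t \<le> k" unfolding K_def k_def using pos by (intro divide_left_mono mult_pos_pos) auto
      then show ?thesis using hM by (simp add: mult_left_mono)
    qed
    then show ?thesis unfolding integral_unique[OF I, symmetric]
      by (intro integral_norm_bound_integral int(3) has_integral_integrable[OF I])
  qed
  have "cmod (poisson \<gamma> z - k *\<^sub>R poisson \<gamma> 0) \<le>
     1 / (2 * pi) * ((pi + 4 * arctan r - pi * k) * M + (pi * k - (pi - 4 * arctan r)) * M)"
    unfolding eq norm_scaleR using order_trans[OF norm_triangle_ineq add_mono[OF near far]]
    by (simp add: divide_right_mono)
  \<comment> \<open>Both half circles have length pi, so the terms with \<open>k\<close> cancel and
    8 arctan r remains, to be divided by 2 pi.\<close>
  also have "\<dots> = 4 / pi * M * arctan r" by (simp add: field_simps)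
  finally show ?thesis by (simp add: k_def r_def)
qed

section \<open>Boundary values of the Poisson integral\<close>

definition poisson_ext :: "(complex \<Rightarrow> complex) \<Rightarrow> complex \<Rightarrow> complex" where
  "poisson_ext \<gamma> z = (if z \<in> ball 0 1 then poisson \<gamma> z else \<gamma> z)"

lemma zzbar_on_poisson_ext:
  "continuous_on (sphere 0 1) \<gamma> \<Longrightarrow> zzbar_on (ball 0 1) (poisson_ext \<gamma>) (\<lambda>z. 0)"
  by (rule zzbar_on_cong[OF zzbar_on_poisson]) (auto simp: poisson_ext_def)

text \<open>The kernel is an approximate identity: on the arc within \<delta> of \<zeta> the data
  differ from a by at most e and the kernel has mean 1; elsewhere the arc stays at distance at least
  \<delta>/2 from z, where the kernel is at most 4 (1 - |z|^2) / \<delta>^2.\<close>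

lemma poisson_boundary_estimate:
  assumes \<gamma>: "continuous_on (sphere 0 1) \<gamma>" and \<delta>: "\<delta> > 0"
    and near: "\<And>x. x \<in> sphere 0 1 \<Longrightarrow> dist x \<zeta> < \<delta> \<Longrightarrow> cmod (\<gamma> x - a) \<le> e"
    and M: "\<And>x. x \<in> sphere 0 1 \<Longrightarrow> cmod (\<gamma> x - a) \<le> M" and e: "0 \<le> e"
    and z: "cmod z < 1" "dist z \<zeta> \<le> \<delta> / 2"
  shows "cmod (poisson \<gamma> z - a) \<le> e + 4 * M / \<delta>\<^sup>2 * (1 - (cmod z)\<^sup>2)"
proof -
  let ?m = "(1 - (cmod z)\<^sup>2) * (4 / \<delta>\<^sup>2) * M"
  have z2: "(cmod z)\<^sup>2 < 1" using z by (simp add: abs_square_less_1)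
  have M0: "M \<ge> 0" using order_trans[OF norm_ge_zero M[of 1]] by simp
  have pk0: "poisson_kernel z t \<ge> 0" for t using z2 by (simp add: poisson_kernel_def)
  note I = poisson_kernel_integral[OF z(1)]
  have ip: "(\<lambda>t. poisson_kernel z t *\<^sub>R \<gamma> (cis t)) integrable_on {0..2 * pi}"
    and ia: "(\<lambda>t. poisson_kernel z t *\<^sub>R a) integrable_on {0..2 * pi}"
    by (intro integrable_continuous_interval continuous_intros continuous_on_poisson_kernel z continuous_on_circle \<gamma>)+
  have i\<gamma>: "(\<lambda>t. poisson_kernel z t *\<^sub>R (\<gamma> (cis t) - a)) integrable_on {0..2 * pi}"
    by (intro integrable_continuous_interval continuous_intros continuous_on_poisson_kernel z continuous_on_circle \<gamma>)
  have a: "a = (1 / (2 * pi)) *\<^sub>R integral {0..2 * pi} (\<lambda>t. poisson_kernel z t *\<^sub>R a)"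
    using has_integral_scaleR_left[OF I, of a] by (simp add: integral_unique)
  have "poisson \<gamma> z - a = (1 / (2 * pi)) *\<^sub>R integral {0..2 * pi} (\<lambda>t. poisson_kernel z t *\<^sub>R (\<gamma> (cis t) - a))"
    by (subst a) (simp add: poisson_eq scaleR_diff_right integral_diff[OF ip ia])
  moreover have "cmod (integral {0..2 * pi} (\<lambda>t. poisson_kernel z t *\<^sub>R (\<gamma> (cis t) - a))) \<le> 2 * pi * e + 2 * pi * ?m"
  proof -
    have J: "((\<lambda>t. poisson_kernel z t * e + ?m) has_integral 2 * pi * e + 2 * pi * ?m) {0..2 * pi}"
      using has_integral_add[OF has_integral_mult_left[OF I, of e] has_integral_const_real[of ?m 0 "2 * pi"]]
      by simp
    \<comment> \<open>Dominating the integrand everywhere by the sum of the near and the far bound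
      avoids cutting the interval of integration.\<close>
    have "cmod (poisson_kernel z t *\<^sub>R (\<gamma> (cis t) - a)) \<le> poisson_kernel z t * e + ?m" for t
    proof (cases "dist (cis t) \<zeta> < \<delta>")
      case True
      have "cmod (poisson_kernel z t *\<^sub>R (\<gamma> (cis t) - a)) \<le> poisson_kernel z t * e"
        using near[OF _ True] pk0[of t] by (simp add: mult_left_mono)
      moreover have "0 \<le> ?m" using z2 M0 by simp
      ultimately show ?thesis by simp
    next
      case False
      have "dist (cis t) \<zeta> \<le> dist (cis t) z + dist z \<zeta>" by (rule dist_triangle)
      then have "\<delta> / 2 \<le> cmod (cis t - z)" using False z(2) by (simp add: dist_norm)
      also have "cis t - z = cis t * (1 - z * cis (- t))"
        by (simp add: algebra_simps cis_mult)
      also have "cmod \<dots> = cmod (1 - z * cis (- t))" by (simp add: norm_mult)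
      finally have "(\<delta> / 2)\<^sup>2 \<le> (cmod (1 - z * cis (- t)))\<^sup>2" using \<delta> by (intro power_mono) auto
      then have "poisson_kernel z t \<le> (1 - (cmod z)\<^sup>2) / (\<delta> / 2)\<^sup>2"
        unfolding poisson_kernel_def using z2 \<delta>
        by (intro divide_left_mono mult_pos_pos) (auto simp: one_minus_mult_cis_nonzero z(1))
      then have "poisson_kernel z t * cmod (\<gamma> (cis t) - a) \<le> (1 - (cmod z)\<^sup>2) / (\<delta> / 2)\<^sup>2 * M"
        using M[of "cis t"] z2 by (intro mult_mono) auto
      then show ?thesis using pk0[of t] e by (simp add: power_divide add_increasing)
    qed
    then show ?thesis unfolding integral_unique[OF J, symmetric]
      by (intro integral_norm_bound_integral i\<gamma> has_integral_integrable[OF J])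
  qed
  ultimately have "cmod (poisson \<gamma> z - a) \<le> 1 / (2 * pi) * (2 * pi * e + 2 * pi * ?m)"
    by (simp add: divide_right_mono)
  also have "\<dots> = e + 4 * M / \<delta>\<^sup>2 * (1 - (cmod z)\<^sup>2)" by (simp add: field_simps)
  finally show ?thesis .
qed

lemma continuous_on_poisson_ext:
  assumes \<gamma>: "continuous_on (sphere 0 1) \<gamma>"
  shows "continuous_on (cball 0 1) (poisson_ext \<gamma>)"
  unfolding continuous_on_eq_continuous_within
proof
  fix \<zeta> :: complex assume \<zeta>: "\<zeta> \<in> cball 0 1"
  show "continuous (at \<zeta> within cball 0 1) (poisson_ext \<gamma>)"
  proof (cases "\<zeta> \<in> ball 0 1")
    case True
    then show ?thesis
      using zzbar_on_continuous[OF zzbar_on_poisson_ext[OF \<gamma>]] continuous_at_imp_continuous_at_within by blast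
  next
    case False
    then have \<zeta>1: "\<zeta> \<in> sphere 0 1" using \<zeta> by auto
    have ext: "poisson_ext \<gamma> \<zeta> = \<gamma> \<zeta>" using False by (simp add: poisson_ext_def)
    have "compact ((\<lambda>x. \<gamma> x - \<gamma> \<zeta>) ` sphere 0 1)"
      by (intro compact_continuous_image continuous_intros \<gamma>) auto
    then obtain M where M: "M > 0" "\<And>x. x \<in> sphere 0 1 \<Longrightarrow> cmod (\<gamma> x - \<gamma> \<zeta>) \<le> M"
      using compact_imp_bounded bounded_pos by (metis (no_types, lifting) imageI)
    show ?thesis unfolding continuous_within_eps_delta
    proof (intro allI impI)
      fix e :: real assume e: "e > 0"
      obtain \<delta> where \<delta>: "\<delta> > 0" "\<And>x. x \<in> sphere 0 1 \<Longrightarrow> dist x \<zeta> < \<delta> \<Longrightarrow> dist (\<gamma> x) (\<gamma> \<zeta>) < e / 2"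
        using \<gamma> \<zeta>1 e unfolding continuous_on_iff by (metis half_gt_zero)
      \<comment> \<open>Within d of \<zeta> one has 1 - |x|^2 \<le> 2 |x - \<zeta>| < 2 e \<delta>^2
        / (16 M), which the factor 4 M / \<delta>^2 turns into e / 2.\<close>
      define d where "d = min (\<delta> / 2) (e * \<delta>\<^sup>2 / (16 * M))"
      have d: "d > 0" using \<delta>(1) e M(1) by (simp add: d_def)
      have "dist (poisson_ext \<gamma> x) (poisson_ext \<gamma> \<zeta>) < e" if x: "x \<in> cball 0 1" "dist x \<zeta> < d" for x
      proof (cases "x \<in> ball 0 1")
        case True
        then have x1: "cmod x < 1" by simp
        have "1 - (cmod x)\<^sup>2 = (1 - cmod x) * (1 + cmod x)" by (simp add: power2_eq_square algebra_simps)
        also have "\<dots> \<le> (1 - cmod x) * 2" using x1 by (intro mult_left_mono) auto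
        also have "1 - cmod x \<le> dist x \<zeta>"
          using norm_triangle_ineq2[of \<zeta> x] \<zeta>1 by (simp add: dist_norm norm_minus_commute)
        also have "\<dots> * 2 < 2 * (e * \<delta>\<^sup>2 / (16 * M))" using x(2) by (simp add: d_def)
        finally have "4 * M / \<delta>\<^sup>2 * (1 - (cmod x)\<^sup>2) < 4 * M / \<delta>\<^sup>2 * (2 * (e * \<delta>\<^sup>2 / (16 * M)))"
          using M(1) \<delta>(1) by (intro mult_strict_left_mono) auto
        also have "\<dots> = e / 2" using M(1) \<delta>(1) by (simp add: field_simps)
        finally have "4 * M / \<delta>\<^sup>2 * (1 - (cmod x)\<^sup>2) < e / 2" .
        moreover have "cmod (poisson \<gamma> x - \<gamma> \<zeta>) \<le> e / 2 + 4 * M / \<delta>\<^sup>2 * (1 - (cmod x)\<^sup>2)"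
          by (rule poisson_boundary_estimate[OF \<gamma> \<delta>(1) _ M(2) _ x1, of \<zeta>])
            (use \<delta>(2) e x(2) in \<open>auto simp: d_def dist_norm less_imp_le\<close>)
        ultimately show ?thesis using True ext by (simp add: poisson_ext_def dist_norm)
      next
        case False
        then have "x \<in> sphere 0 1" using x by auto
        then show ?thesis using \<delta>(2)[of x] x(2) False ext e \<delta>(1) by (force simp: poisson_ext_def d_def)
      qed
      then show "\<exists>d>0. \<forall>x'\<in>cball 0 1. dist x' \<zeta> < d \<longrightarrow> dist (poisson_ext \<gamma> x') (poisson_ext \<gamma> \<zeta>) < e"
        using d by blast
    qed
  qed
qed

text \<open>A real supremum dominates its members only if the set is bounded above; the compact
  \<open>K\<close> provides this also when \<open>S\<close> is the open disc.\<close>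

lemma sup_norm_upper:
  assumes "continuous_on K f" "compact K" "S \<subseteq> K" "z \<in> S"
  shows "cmod (f z) \<le> sup_norm_on S f"
proof -
  have "bounded (f ` K)" by (intro compact_imp_bounded compact_continuous_image assms)
  then have "bdd_above ((\<lambda>z. cmod (f z)) ` S)"
    using assms(3) by (fastforce simp: bounded_iff bdd_above_def)
  then show ?thesis unfolding sup_norm_on_def using assms(4) by (rule cSUP_upper[rotated])
qed

text \<open>The bound passes to the closure of the disc by continuity of \<open>poisson_ext\<close>.
  It connects the norm of the Poisson integral in the theorem with the bound on the boundary data in
  \<open>poisson_schwarz\<close>.\<close>

lemma poisson_sup_norm:
  assumes \<gamma>: "continuous_on (sphere 0 1) \<gamma>" and x: "x \<in> sphere 0 1"
  shows "cmod (\<gamma> x) \<le> sup_norm_on (ball 0 1) (poisson \<gamma>)"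
proof -
  have c: "continuous_on (cball 0 1) (poisson_ext \<gamma>)" by (rule continuous_on_poisson_ext[OF \<gamma>])
  have "sup_norm_on (ball 0 1) (poisson_ext \<gamma>) = sup_norm_on (ball 0 1) (poisson \<gamma>)"
    unfolding sup_norm_on_def by (rule SUP_cong) (simp_all add: poisson_ext_def)
  then have le: "cmod (poisson_ext \<gamma> z) \<le> sup_norm_on (ball 0 1) (poisson \<gamma>)" if "z \<in> ball 0 1" for z
    using sup_norm_upper[OF c compact_cball ball_subset_cball that] by simp
  have "cmod (poisson_ext \<gamma> x) \<le> sup_norm_on (ball 0 1) (poisson \<gamma>)"
    by (rule continuous_on_closure_norm_le[of "ball 0 1" "poisson_ext \<gamma>"])
      (use c le x in \<open>auto simp del: mem_ball\<close>)
  then show ?thesis using x by (simp add: poisson_ext_def)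
qed

section \<open>A priori bounds\<close>

text \<open>For nonzero x the choice \<mu> = cnj x / |x| makes \<mu> x equal to |x|. This carries
  real maximum principles over to complex-valued functions.\<close>

lemma norm_le_if_Re_le:
  assumes "\<And>\<mu>. cmod \<mu> = 1 \<Longrightarrow> Re (\<mu> * x) \<le> M"
  shows "cmod x \<le> M"
proof (cases "x = 0")
  case True
  then show ?thesis using assms[of 1] by simp
next
  case False
  have "cnj x / of_real (cmod x) * x = of_real ((cmod x)\<^sup>2) / of_real (cmod x)"
    unfolding complex_norm_square by simp
  then have "cnj x / of_real (cmod x) * x = of_real (cmod x)"
    using False by (simp add: power2_eq_square)
  then show ?thesis using assms[of "cnj x / of_real (cmod x)"] False by (simp add: norm_divide)
qed

lemma Re_scaled_norm_square: "Re (of_real M * (z * cnj z)) = M * (cmod z)\<^sup>2"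
  by (simp only: complex_norm_square[symmetric] of_real_mult[symmetric] Re_complex_of_real)

text \<open>The function Re (\<mu> h) + M |z|^2 is subharmonic, because |z|^2 has mixed derivative 1
  and \<open>M\<close> dominates \<open>L\<close>; on the circle it is at most B + M.\<close>

lemma zzbar_disc_bound:
  assumes h: "continuous_on (cball 0 1) h" "zzbar_on (ball 0 1) h L"
    and L: "\<And>z. z \<in> ball 0 1 \<Longrightarrow> cmod (L z) \<le> M"
    and B: "\<And>z. z \<in> sphere 0 1 \<Longrightarrow> cmod (h z) \<le> B" and z: "z \<in> cball 0 1"
  shows "cmod (h z) \<le> B + M * (1 - (cmod z)\<^sup>2)"
proof (rule norm_le_if_Re_le)
  fix \<mu> :: complex assume \<mu>: "cmod \<mu> = 1"
  have "Re (\<mu> * h z + of_real M * (z * cnj z)) \<le> B + M"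
  proof (rule zzbar_le_boundary[OF _ _ _ _ z, where f = "\<lambda>z. \<mu> * h z + of_real M * (z * cnj z)"])
    show "zzbar_on (ball 0 1) (\<lambda>z. \<mu> * h z + of_real M * (z * cnj z)) (\<lambda>z. \<mu> * L z + of_real M * 1)"
      by (intro zzbar_on_add zzbar_on_cmult h zzbar_on_norm_square)
    show "0 \<le> Re (\<mu> * L z + of_real M * 1)" if "z \<in> ball 0 1" for z
      using L[OF that] abs_Re_le_cmod[of "\<mu> * L z"] \<mu> by (simp add: norm_mult del: times_complex.sel)
    show "Re (\<mu> * h z + of_real M * (z * cnj z)) \<le> B + M" if "z \<in> sphere 0 1" for z
      using B[OF that] complex_Re_le_cmod[of "\<mu> * h z"] \<mu> that
      by (simp add: norm_mult Re_scaled_norm_square del: times_complex.sel)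
  qed (intro continuous_intros h)
  then show "Re (\<mu> * h z) \<le> B + M * (1 - (cmod z)\<^sup>2)"
    by (simp add: Re_scaled_norm_square right_diff_distrib del: times_complex.sel)
qed

lemma has_real_derivative_Re:
  "(f has_vector_derivative d) F \<Longrightarrow> ((\<lambda>x. Re (f x)) has_real_derivative Re d) F"
  unfolding has_vector_derivative_def has_field_derivative_def
  by (drule has_derivative_Re) (simp add: mult.commute[of _ "Re d"])

text \<open>
  The barrier $\Phi = a (x^2 - y^2 + 4 y) + b (8 y - 4 y^2)$ is nonnegative on the diameter, satisfies
  $\Phi_{z \overline z} = - 2 b$, and with $s = \sin \theta \in [0, 1]$ its normal derivative at $e^{i \theta}$
  is $2 a + (4 a + 8 b) s (1 - s) \ge 2 a$.
\<close>

lemma reflection_difference_bound: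
  assumes v: "continuous_on (cball 0 1) v" "zzbar_on (ball 0 1) v g"
    and g: "\<And>z. z \<in> ball 0 1 \<Longrightarrow> cmod (g z) \<le> G"
    and \<gamma>: "\<And>z. z \<in> sphere 0 1 \<Longrightarrow> cmod (\<gamma> z) \<le> \<Gamma>"
    and n: "\<And>z. z \<in> sphere 0 1 \<Longrightarrow> has_normal_derivative v (\<gamma> z) z"
    and z: "cmod z = 1" "Im z \<ge> 0" and "cmod \<mu> = 1"
  shows "Re (\<mu> * (v z - v (cnj z))) \<le> 3 * \<Gamma> + 4 * G"
proof (rule field_le_epsilon)
  fix e :: real assume e: "e > 0"
  \<comment> \<open>The shares e/7 make \<open>a\<close> and \<open>b\<close> strictly larger than
    \<Gamma> and \<open>G\<close>, and since 3 + 4 = 7 the final bound 3a + 4b exceeds the desired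
    one by exactly e.\<close>
  define a b where "a = \<Gamma> + e / 7" and "b = G + e / 7"
  \<comment> \<open>Only the real part is the barrier. The complex form separates a holomorphic
    polynomial, with zero mixed derivative, from -2b |z|^2, which supplies -2b.\<close>
  define \<Phi> where "\<Phi> z = of_real a * (z\<^sup>2 - 4 * \<i> * z) + of_real b * (2 * z\<^sup>2 - 8 * \<i> * z - 2 * (z * cnj z))" for z
  define f where "f z = \<mu> * (v z - v (cnj z)) - \<Phi> z" for z
  define K where "K = {z. cmod z \<le> 1 \<and> 0 \<le> Im z}"
  define U where "U = {z. cmod z < 1 \<and> 0 < Im z}"
  have "0 \<le> \<Gamma>" using order_trans[OF norm_ge_zero \<gamma>[of 1]] by simp
  have "0 \<le> G" using order_trans[OF norm_ge_zero g[of 0]] by simp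
  have pos: "a > 0" "b > 0" using \<open>0 \<le> \<Gamma>\<close> \<open>0 \<le> G\<close> e by (simp_all add: a_def b_def add_nonneg_pos)
  have Re_\<Phi>: "Re (\<Phi> z) = a * ((Re z)\<^sup>2 - (Im z)\<^sup>2 + 4 * Im z) + b * (8 * Im z - 4 * (Im z)\<^sup>2)" for z
    by (simp add: \<Phi>_def power2_eq_square algebra_simps)
  have "Re (f z) \<le> 0"
  proof (rule half_disc_le_0[where f = f and z = z and L = "\<lambda>z. \<mu> * (g z - g (cnj z)) + 2 * of_real b"
        and d = "\<lambda>z. Re (\<mu> * (\<gamma> z - \<gamma> (cnj z))) - (2 * a * ((Re z)\<^sup>2 - (Im z)\<^sup>2 + 2 * Im z) + 8 * b * (Im z - (Im z)\<^sup>2))"])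
    have "continuous_on K (\<lambda>z. v (cnj z))"
      by (intro continuous_on_compose2[OF v(1)] continuous_intros) (auto simp: K_def)
    moreover have "continuous_on K v" using v(1) by (rule continuous_on_subset) (auto simp: K_def)
    ultimately show "continuous_on {z. cmod z \<le> 1 \<and> 0 \<le> Im z} f"
      unfolding f_def \<Phi>_def K_def[symmetric] by (intro continuous_intros)
    have U: "open U" using open_Int[OF open_ball[of 0 1] open_halfspace_Im_gt[of 0]]
      by (simp add: U_def ball_def Int_def)
    have 1: "zzbar_on U (\<lambda>z. v z - v (cnj z)) (\<lambda>z. g z - g (cnj z))"
      by (intro zzbar_on_diff zzbar_on_subset[OF v(2)] zzbar_on_compose_cnj[OF v(2)]) (auto simp: U_def)
    have 2: "zzbar_on U (\<lambda>z. of_real a * (z\<^sup>2 - 4 * \<i> * z) + of_real b * (2 * z\<^sup>2 - 8 * \<i> * z)) (\<lambda>z. 0)"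
      by (intro zzbar_on_holomorphic U holomorphic_intros)
    show "zzbar_on {z. cmod z < 1 \<and> 0 < Im z} f (\<lambda>z. \<mu> * (g z - g (cnj z)) + 2 * of_real b)"
      unfolding U_def[symmetric]
      by (rule zzbar_on_cong[OF zzbar_on_diff[OF zzbar_on_cmult[OF 1, of \<mu>] zzbar_on_add[OF 2
              zzbar_on_cmult[OF zzbar_on_norm_square, of U "- 2 * of_real b"]]] U])
        (auto simp: f_def \<Phi>_def algebra_simps)
    show "0 < Re (\<mu> * (g z - g (cnj z)) + 2 * of_real b)" if "cmod z < 1" "0 < Im z" for z
    proof -
      have "\<bar>Re (\<mu> * (g z - g (cnj z)))\<bar> \<le> cmod (g z - g (cnj z))"
        using abs_Re_le_cmod[of "\<mu> * (g z - g (cnj z))"] \<open>cmod \<mu> = 1\<close> by (simp only: norm_mult mult_1)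
      also have "\<dots> \<le> G + G" using that by (intro order_trans[OF norm_triangle_ineq4] add_mono g) auto
      also have "\<dots> < 2 * b" using e by (simp add: b_def)
      finally have "\<bar>Re (\<mu> * (g z - g (cnj z)))\<bar> < 2 * b" .
      moreover have "Re (2 * complex_of_real b) = 2 * b" by simp
      ultimately show ?thesis unfolding plus_complex.sel by linarith
    qed
    show "Re (f z) \<le> 0" if "Im z = 0" "cmod z \<le> 1" for z
    proof -
      have "cnj z = z" using that by (simp add: complex_eq_iff)
      then show ?thesis using that pos(1) by (simp add: f_def Re_\<Phi>)
    qed
    show "((\<lambda>r. Re (f (of_real r * z))) has_real_derivative
        Re (\<mu> * (\<gamma> z - \<gamma> (cnj z))) - (2 * a * ((Re z)\<^sup>2 - (Im z)\<^sup>2 + 2 * Im z) + 8 * b * (Im z - (Im z)\<^sup>2)))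
        (at 1 within {0..1}) \<and>
      Re (\<mu> * (\<gamma> z - \<gamma> (cnj z))) - (2 * a * ((Re z)\<^sup>2 - (Im z)\<^sup>2 + 2 * Im z) + 8 * b * (Im z - (Im z)\<^sup>2)) < 0"
      if "cmod z = 1" "0 < Im z" for z
    proof
      have "((\<lambda>r. \<mu> * (v (of_real r * z) - v (of_real r * cnj z))) has_vector_derivative \<mu> * (\<gamma> z - \<gamma> (cnj z)))
          (at 1 within {0..1})"
        using n[of z] n[of "cnj z"] that unfolding has_normal_derivative_def scaleR_conv_of_real
        by (intro has_vector_derivative_mult_right has_vector_derivative_diff) auto
      note D1 = has_real_derivative_Re[OF this]
      have D2: "((\<lambda>r. a * ((r * Re z)\<^sup>2 - (r * Im z)\<^sup>2 + 4 * (r * Im z)) + b * (8 * (r * Im z) - 4 * (r * Im z)\<^sup>2))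
          has_real_derivative 2 * a * ((Re z)\<^sup>2 - (Im z)\<^sup>2 + 2 * Im z) + 8 * b * (Im z - (Im z)\<^sup>2)) (at 1 within {0..1})"
        by (auto intro!: derivative_eq_intros simp: power2_eq_square algebra_simps)
      have "Re (f (of_real r * z)) = Re (\<mu> * (v (of_real r * z) - v (of_real r * cnj z))) -
          (a * ((r * Re z)\<^sup>2 - (r * Im z)\<^sup>2 + 4 * (r * Im z)) + b * (8 * (r * Im z) - 4 * (r * Im z)\<^sup>2))" for r
        unfolding f_def minus_complex.sel Re_\<Phi> by simp
      then show "((\<lambda>r. Re (f (of_real r * z))) has_real_derivative
          Re (\<mu> * (\<gamma> z - \<gamma> (cnj z))) - (2 * a * ((Re z)\<^sup>2 - (Im z)\<^sup>2 + 2 * Im z) + 8 * b * (Im z - (Im z)\<^sup>2)))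
          (at 1 within {0..1})"
        using DERIV_diff[OF D1 D2] by presburger
      have "\<bar>Re (\<mu> * (\<gamma> z - \<gamma> (cnj z)))\<bar> \<le> cmod (\<gamma> z - \<gamma> (cnj z))"
        using abs_Re_le_cmod[of "\<mu> * (\<gamma> z - \<gamma> (cnj z))"] \<open>cmod \<mu> = 1\<close> by (simp only: norm_mult mult_1)
      also have "\<dots> \<le> \<Gamma> + \<Gamma>"
        using that by (intro order_trans[OF norm_triangle_ineq4] add_mono \<gamma>) auto
      also have "\<dots> < 2 * a" using e by (simp add: a_def)
      finally have 1: "Re (\<mu> * (\<gamma> z - \<gamma> (cnj z))) < 2 * a" by (simp del: times_complex.sel)
      have "(Re z)\<^sup>2 + (Im z)\<^sup>2 = 1" using that(1) cmod_power2[of z] by simp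
      then have "(Re z)\<^sup>2 - (Im z)\<^sup>2 + 2 * Im z = 1 + 2 * (Im z - (Im z)\<^sup>2)" by simp
      moreover have "Im z - (Im z)\<^sup>2 \<ge> 0"
        using that abs_Im_le_cmod[of z] mult_left_mono[of "Im z" 1 "Im z"] by (simp add: power2_eq_square)
      ultimately have "2 * a * 1 + 0 \<le> 2 * a * ((Re z)\<^sup>2 - (Im z)\<^sup>2 + 2 * Im z) + 8 * b * (Im z - (Im z)\<^sup>2)"
        using pos by (intro add_mono mult_left_mono) auto
      with 1 show "Re (\<mu> * (\<gamma> z - \<gamma> (cnj z))) - (2 * a * ((Re z)\<^sup>2 - (Im z)\<^sup>2 + 2 * Im z) + 8 * b * (Im z - (Im z)\<^sup>2)) < 0"
        by linarith
    qed
  qed (use z in auto)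
  \<comment> \<open>On the circle the two quadratics are 1 + 2 (2y - y^2) and 4 (2y - y^2), and 2y -
    y^2 \<le> 1.\<close>
  moreover have "Re (\<Phi> z) \<le> a * 3 + b * 4"
  proof -
    have sq: "(Re z)\<^sup>2 + (Im z)\<^sup>2 = 1" using z(1) cmod_power2[of z] by simp
    have "(Im z - 1)\<^sup>2 \<ge> 0" by simp
    then have I: "2 * Im z - (Im z)\<^sup>2 \<le> 1" by (simp add: power2_eq_square algebra_simps)
    show ?thesis unfolding Re_\<Phi>
      using pos sq I by (intro add_mono mult_left_mono) linarith+
  qed
  moreover have "a * 3 + b * 4 = 3 * \<Gamma> + 4 * G + e" by (simp add: a_def b_def)
  ultimately show "Re (\<mu> * (v z - v (cnj z))) \<le> 3 * \<Gamma> + 4 * G + e"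
    unfolding f_def minus_complex.sel(1)[of "\<mu> * _"] by linarith
qed

text \<open>Rotation by \<omega> with \<omega>^2 = xy carries a conjugate pair z, cnj z to x, y, and
  all hypotheses are invariant under rotation.\<close>

lemma circle_oscillation_bound:
  assumes v: "continuous_on (cball 0 1) v" "zzbar_on (ball 0 1) v g"
    and g: "\<And>z. z \<in> ball 0 1 \<Longrightarrow> cmod (g z) \<le> G"
    and \<gamma>: "\<And>z. z \<in> sphere 0 1 \<Longrightarrow> cmod (\<gamma> z) \<le> \<Gamma>"
    and n: "\<And>z. z \<in> sphere 0 1 \<Longrightarrow> has_normal_derivative v (\<gamma> z) z"
    and x: "cmod x = 1" and y: "cmod y = 1"
  shows "cmod (v x - v y) \<le> 3 * \<Gamma> + 4 * G"
proof -
  \<comment> \<open>The sign of the square root is chosen so that x * cnj \<omega> lies in the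
    closed upper half plane.\<close>
  obtain \<omega> where \<omega>: "\<omega>\<^sup>2 = x * y" "Im (x * cnj \<omega>) \<ge> 0"
  proof (cases "Im (x * cnj (csqrt (x * y))) \<ge> 0")
    case True
    then show ?thesis by (intro that[of "csqrt (x * y)"]) auto
  next
    case False
    then show ?thesis by (intro that[of "- csqrt (x * y)"]) (auto simp: algebra_simps)
  qed
  have "(cmod \<omega>)\<^sup>2 = 1" using \<omega>(1) x y by (metis mult_1 norm_mult norm_power)
  then have m: "cmod \<omega> = 1" by (simp add: abs_square_eq_1)
  define z where "z = x * cnj \<omega>"
  have unit: "u * cnj u = 1" if "cmod u = 1" for u using that by (simp add: complex_norm_square[symmetric])
  have z: "cmod z = 1" "Im z \<ge> 0" using \<omega>(2) x m by (auto simp: z_def norm_mult)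
  have "\<omega> * z = x * (\<omega> * cnj \<omega>)" by (simp add: z_def mult_ac)
  then have zx: "\<omega> * z = x" using unit[OF m] by simp
  have "\<omega> * cnj z = \<omega>\<^sup>2 * cnj x" by (simp add: z_def power2_eq_square)
  also have "\<dots> = y * (x * cnj x)" by (simp add: \<omega>(1) mult_ac)
  finally have zy: "\<omega> * cnj z = y" using unit[OF x] by simp
  have bound: "Re (\<mu> * (v (\<omega> * z) - v (\<omega> * cnj z))) \<le> 3 * \<Gamma> + 4 * G" if "cmod \<mu> = 1" for \<mu>
  proof (rule reflection_difference_bound[OF _ _ _ _ _ z that, where v = "\<lambda>z. v (\<omega> * z)"
        and g = "\<lambda>z. g (\<omega> * z)" and \<gamma> = "\<lambda>z. \<gamma> (\<omega> * z)"])
    show "continuous_on (cball 0 1) (\<lambda>z. v (\<omega> * z))"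
      by (intro continuous_on_compose2[OF v(1)] continuous_intros) (auto simp: norm_mult m)
    show "zzbar_on (ball 0 1) (\<lambda>z. v (\<omega> * z)) (\<lambda>z. g (\<omega> * z))"
      by (rule zzbar_on_compose_cmult[OF v(2) _ m]) (auto simp: norm_mult m)
    show "has_normal_derivative (\<lambda>z. v (\<omega> * z)) (\<gamma> (\<omega> * \<zeta>)) \<zeta>" if "\<zeta> \<in> sphere 0 1" for \<zeta>
      using n[of "\<omega> * \<zeta>"] that by (simp add: has_normal_derivative_def norm_mult m)
  qed (auto intro!: g \<gamma> simp: norm_mult m)
  show ?thesis using norm_le_if_Re_le[of "v (\<omega> * z) - v (\<omega> * cnj z)", OF bound] by (simp add: zx zy)
qed

text \<open>On the circle d\<zeta> / \<zeta> = i dt, so \<open>c\<close> is the mean of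
  \<open>v\<close>, and v(x) - c is the mean of the differences v(x) - v(y).\<close>

lemma circle_mean_bound:
  assumes v: "continuous_on (sphere 0 1) v"
    and osc: "\<And>x y. cmod x = 1 \<Longrightarrow> cmod y = 1 \<Longrightarrow> cmod (v x - v y) \<le> B"
    and c: "1 / (2 * complex_of_real pi * \<i>) * contour_integral (circlepath 0 1) (\<lambda>\<zeta>. v \<zeta> / \<zeta>) = c"
    and x: "cmod x = 1"
  shows "cmod (v x - c) \<le> B"
proof -
  have iv: "(\<lambda>t. v (cis t)) integrable_on {0..2 * pi}"
    by (intro integrable_continuous_interval continuous_on_circle v)
  have "contour_integral (circlepath 0 1) (\<lambda>\<zeta>. v \<zeta> / \<zeta>) = integral {0..2 * pi} (\<lambda>t. \<i> * v (cis t))"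
    unfolding circlepath_def by (subst contour_integral_part_circlepath_eq) (simp_all add: mult_ac)
  also have "\<dots> = \<i> * integral {0..2 * pi} (\<lambda>t. v (cis t))" by simp
  finally have c': "c = (1 / (2 * pi)) *\<^sub>R integral {0..2 * pi} (\<lambda>t. v (cis t))"
    using c by (simp add: scaleR_conv_of_real field_simps)
  have "v x = (1 / (2 * pi)) *\<^sub>R integral {0..2 * pi} (\<lambda>t. v x)"
    by (simp add: scaleR_conv_of_real)
  then have "v x - c = (1 / (2 * pi)) *\<^sub>R (integral {0..2 * pi} (\<lambda>t. v x) - integral {0..2 * pi} (\<lambda>t. v (cis t)))"
    unfolding c' scaleR_diff_right by simp
  also have "\<dots> = (1 / (2 * pi)) *\<^sub>R integral {0..2 * pi} (\<lambda>t. v x - v (cis t))"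
    by (subst integral_diff) (use iv in auto)
  finally have eq: "v x - c = \<dots>" .
  have "cmod (integral {0..2 * pi} (\<lambda>t. v x - v (cis t))) \<le> integral {0..2 * pi} (\<lambda>t. B)"
    by (intro integral_norm_bound_integral integrable_diff iv osc x) auto
  then show ?thesis unfolding eq by (simp add: field_simps)
qed

text \<open>As pi \<ge> 3, the root of pi^2 / 6 is at least 1, so the last summands are at least 4
  and 16/3; the others are nonnegative.\<close>

lemma N_lower_bounds:
  assumes "0 \<le> t" "t \<le> 1"
  shows "3 \<le> N\<^sub>1 t" "5 \<le> N\<^sub>2 t"
proof -
  have pi2: "9 \<le> pi\<^sup>2" using power_mono[of 3 pi 2] pi_gt3 by simp
  then have s: "1 \<le> sqrt (pi\<^sup>2 / 6)" and q: "0 \<le> sqrt (2 / 3 * pi\<^sup>2 - 2)" by simp_all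
  have l: "0 \<le> ln (4 :: real)" by simp
  have "0 \<le> 1 - t\<^sup>2" using assms by (simp add: power_le_one)
  then have "0 \<le> (1 - t\<^sup>2) * sqrt (2 / 3 * pi\<^sup>2 - 2)" using q by (rule mult_nonneg_nonneg)
  then show "3 \<le> N\<^sub>1 t" "5 \<le> N\<^sub>2 t" using s l unfolding N\<^sub>1_def N\<^sub>2_def by linarith+
qed

theorem theorem2p1:
  fixes g \<gamma>\<^sub>0 \<gamma> w :: "complex \<Rightarrow> complex" and c :: complex
  assumes g: "continuous_on (cball 0 1) g"
    and \<gamma>\<^sub>0: "continuous_on (sphere 0 1) \<gamma>\<^sub>0"
    and \<gamma>: "continuous_on (sphere 0 1) \<gamma>"
    and w_C4: "C_k_on 4 (ball 0 1) w"
    and w_cont: "continuous_on (cball 0 1) w"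
    and pde: "\<And>z. z \<in> ball 0 1 \<Longrightarrow> (d_zzbar ^^ 2) w z = g z"
    and dirichlet: "\<And>\<zeta>. \<zeta> \<in> sphere 0 1 \<Longrightarrow> w \<zeta> = \<gamma>\<^sub>0 \<zeta>"
    and trace: "continuous_on (cball 0 1) (disc_ext (d_zzbar w))"
    and neumann: "\<And>\<zeta>. \<zeta> \<in> sphere 0 1 \<Longrightarrow>
                    has_normal_derivative (disc_ext (d_zzbar w)) (\<gamma> \<zeta>) \<zeta>"
    and mean: "1 / (2 * complex_of_real pi * \<i>) *
                 contour_integral (circlepath 0 1) (\<lambda>\<zeta>. disc_ext (d_zzbar w) \<zeta> / \<zeta>) = c"
    and compat: "(1 / (2 * pi)) *\<^sub>R integral {0..2 * pi} (\<lambda>t. \<gamma> (cis t)) =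
                   2 * disc_area_integral g"
  shows "\<forall>z \<in> cball 0 1.
           cmod (w z - ((1 - (cmod z)\<^sup>2) / (1 + (cmod z)\<^sup>2)) *\<^sub>R poisson \<gamma>\<^sub>0 0)
           \<le> 4 / pi * sup_norm_on (ball 0 1) (poisson \<gamma>\<^sub>0) * arctan (cmod z)
             + cmod c
             + sup_norm_on (sphere 0 1) \<gamma> * N\<^sub>1 (cmod z)
             + sup_norm_on (ball 0 1) g * N\<^sub>2 (cmod z)"
proof
  define v where "v = disc_ext (d_zzbar w)"
  define \<Gamma> G P where "\<Gamma> = sup_norm_on (sphere 0 1) \<gamma>" and "G = sup_norm_on (ball 0 1) g"
    and "P = sup_norm_on (ball 0 1) (poisson \<gamma>\<^sub>0)"
  have \<Gamma>: "cmod (\<gamma> z) \<le> \<Gamma>" if "z \<in> sphere 0 1" for z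
    unfolding \<Gamma>_def using sup_norm_upper[OF \<gamma>] that by simp
  have G: "cmod (g z) \<le> G" if "z \<in> ball 0 1" for z
    unfolding G_def using sup_norm_upper[OF g _ ball_subset_cball] that by simp
  have nonneg: "0 \<le> \<Gamma>" "0 \<le> G"
    using order_trans[OF norm_ge_zero \<Gamma>[of 1]] order_trans[OF norm_ge_zero G[of 0]] by simp_all
  have C2: "C_k_on 2 (ball 0 1) (d_zzbar w)" and "C_k_on 2 (ball 0 1) w"
    using C_k_on_d_zzbar[of "ball 0 1" 2 w] w_C4 C_k_on_Suc_imp[of 2 _ w] C_k_on_Suc_imp[of 3 _ w]
    by (simp_all add: eval_nat_numeral del: C_k_on.simps)
  then have w_v: "zzbar_on (ball 0 1) w v"
    using zzbar_on_cong[OF zzbar_on_d_zzbar[of "ball 0 1" w]] by (simp add: v_def disc_ext_def)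
  have v_g: "zzbar_on (ball 0 1) v g"
    by (rule zzbar_on_cong[OF zzbar_on_d_zzbar[OF _ C2]])
      (use pde in \<open>auto simp: v_def disc_ext_def eval_nat_numeral\<close>)
  have v_cont: "continuous_on (cball 0 1) v" using trace by (simp add: v_def)
  have osc: "cmod (v x - v y) \<le> 3 * \<Gamma> + 4 * G" if "cmod x = 1" "cmod y = 1" for x y
    by (rule circle_oscillation_bound[OF v_cont v_g G \<Gamma> _ that]) (use neumann in \<open>auto simp: v_def\<close>)
  have v_c: "cmod (v x - c) \<le> 3 * \<Gamma> + 4 * G" if "cmod x = 1" for x
    by (rule circle_mean_bound[OF continuous_on_subset[OF v_cont] osc mean[folded v_def] that]) auto
  have v_bound: "cmod (v x) \<le> cmod c + 3 * \<Gamma> + 5 * G" if "x \<in> ball 0 1" for x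
  proof -
    \<comment> \<open>The circle bound for |v| is |c| + 3 \<Gamma> + 4 G; passing to the interior,
      where the mixed derivative of v is g, adds up to one further G.\<close>
    have "cmod (v x) \<le> cmod c + 3 * \<Gamma> + 4 * G + G * (1 - (cmod x)\<^sup>2)"
    proof (rule zzbar_disc_bound[OF v_cont v_g G])
      show "cmod (v z) \<le> cmod c + 3 * \<Gamma> + 4 * G" if "z \<in> sphere 0 1" for z
        using v_c[of z] norm_triangle_sub[of "v z" c] that by simp
    qed (use that in auto)
    also have "\<dots> \<le> cmod c + 3 * \<Gamma> + 4 * G + G * 1" using nonneg by (intro add_left_mono mult_left_mono) auto
    finally show ?thesis by simp
  qed
  fix z :: complex assume z: "z \<in> cball 0 1"
  then have z1: "0 \<le> cmod z" "cmod z \<le> 1" by auto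
  define k where "k = (1 - (cmod z)\<^sup>2) / (1 + (cmod z)\<^sup>2)"
  \<comment> \<open>The summand 0 is the boundary bound: \<open>w\<close> and
    \<open>poisson_ext\<close> agree on the circle, and their difference has mixed derivative
    \<open>v\<close> inside.\<close>
  have "cmod (w z - poisson_ext \<gamma>\<^sub>0 z) \<le> 0 + (cmod c + 3 * \<Gamma> + 5 * G) * (1 - (cmod z)\<^sup>2)"
  proof (rule zzbar_disc_bound[OF _ _ _ _ z])
    show "continuous_on (cball 0 1) (\<lambda>z. w z - poisson_ext \<gamma>\<^sub>0 z)"
      by (intro continuous_intros w_cont continuous_on_poisson_ext \<gamma>\<^sub>0)
    show "zzbar_on (ball 0 1) (\<lambda>z. w z - poisson_ext \<gamma>\<^sub>0 z) (\<lambda>z. v z - 0)"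
      by (intro zzbar_on_diff w_v zzbar_on_poisson_ext \<gamma>\<^sub>0)
  qed (use v_bound dirichlet in \<open>auto simp: poisson_ext_def\<close>)
  also have "\<dots> \<le> 0 + (cmod c + 3 * \<Gamma> + 5 * G) * 1"
    using nonneg by (intro add_left_mono mult_left_mono) auto
  also have "\<dots> \<le> cmod c + \<Gamma> * N\<^sub>1 (cmod z) + G * N\<^sub>2 (cmod z)"
    using mult_left_mono[OF N_lower_bounds(1)[OF z1] nonneg(1)]
      mult_left_mono[OF N_lower_bounds(2)[OF z1] nonneg(2)] by simp
  finally have 1: "cmod (w z - poisson_ext \<gamma>\<^sub>0 z) \<le> cmod c + \<Gamma> * N\<^sub>1 (cmod z) + G * N\<^sub>2 (cmod z)" .
  have M: "cmod (\<gamma>\<^sub>0 x) \<le> P" if "x \<in> sphere 0 1" for x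
    unfolding P_def by (rule poisson_sup_norm[OF \<gamma>\<^sub>0 that])
  have 2: "cmod (poisson_ext \<gamma>\<^sub>0 z - k *\<^sub>R poisson \<gamma>\<^sub>0 0) \<le> 4 / pi * P * arctan (cmod z)"
  proof (cases "cmod z < 1")
    case True
    then show ?thesis using poisson_schwarz[OF \<gamma>\<^sub>0 M True] by (simp add: poisson_ext_def k_def)
  next
    \<comment> \<open>On the circle \<open>k\<close> = 0 and arctan 1 = pi/4, so the claim is just
      the bound \<open>P\<close> for the boundary data.\<close>
    case False
    then have "cmod z = 1" using z1 by simp
    then show ?thesis using M[of z] by (simp add: poisson_ext_def k_def arctan_one)
  qed
  have "cmod (w z - k *\<^sub>R poisson \<gamma>\<^sub>0 0) \<le>
      cmod (w z - poisson_ext \<gamma>\<^sub>0 z) + cmod (poisson_ext \<gamma>\<^sub>0 z - k *\<^sub>R poisson \<gamma>\<^sub>0 0)"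
    using norm_triangle_ineq[of "w z - poisson_ext \<gamma>\<^sub>0 z" "poisson_ext \<gamma>\<^sub>0 z - k *\<^sub>R poisson \<gamma>\<^sub>0 0"] by simp
  with 1 2 show "cmod (w z - ((1 - (cmod z)\<^sup>2) / (1 + (cmod z)\<^sup>2)) *\<^sub>R poisson \<gamma>\<^sub>0 0)
      \<le> 4 / pi * sup_norm_on (ball 0 1) (poisson \<gamma>\<^sub>0) * arctan (cmod z) + cmod c
        + sup_norm_on (sphere 0 1) \<gamma> * N\<^sub>1 (cmod z) + sup_norm_on (ball 0 1) g * N\<^sub>2 (cmod z)"
    unfolding k_def[symmetric] \<Gamma>_def[symmetric] G_def[symmetric] P_def[symmetric] by linarith
qed

end
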